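(* Suppose that: (a) the transition kernel $\mathcal{T}(\cdot|x,u)$ is weakly continuous in $(x,u)$; (b) the channel $Q$ is continuous in total variation, i.e. $\|Q(\cdot|x_n)-Q(\cdot|x)\|_{TV}\to0$ whenever $x_n\to x$; (c) the stage-wise cost function $c:\mathbb{X}\times\mathbb{U}\to\mathbb{R}$ is non-negative, bounded and continuous on $\mathbb{X}\times\mathbb{U}$; (d) $\mathbb{U}$ is compact. If $P_n\to P$ weakly in $\mathcal{P}(\mathbb{X})$, then $|J^*_\beta(P_n,\mathcal{T})-J^*_\beta(P,\mathcal{T})|\to0$.
   Context: $\mathbb{X}\subset\mathbb{R}^n$, $\mathbb{Y}\subset\mathbb{R}^m$ and $\mathbb{U}$ (a subset of some Euclidean space) are Borel sets; $\mathcal{P}(\mathbb{X})$ is the set of Borel probability measures on $\mathbb{X}$. $Q(\cdot|x)$ (the channel) is a stochastic kernel from $\mathbb{X}$ to $\mathbb{Y}$ and $\mathcal{T}(\cdot|x,u)$ is a stochastic kernel from $\mathbb{X}\times\mathbb{U}$ to $\mathbb{X}$; weak continuity of $\mathcal{T}$ means $(x,u)\mapsto\int g(x_1)\mathcal{T}(dx_1|x,u)$ is continuous for every bounded continuous $g$. An admissible policy is a sequence $\gamma=\{\gamma_t\}_{t\ge0}$ of measurable control functions with $U_t=\gamma_t(I_t)\in\mathbb{U}$, where $I_0=\{Y_0\}$, $I_t=\{Y_0,\dots,Y_t,U_0,\dots,U_{t-1}\}$; $\Gamma$ is the set of admissible policies. Given an initial law (prior) $P\in\mathcal{P}(\mathbb{X})$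 and $\gamma\in\Gamma$, the process evolves as $X_0\sim P$, $Y_t\sim Q(\cdot|X_t)$ and $X_{t+1}\sim\mathcal{T}(\cdot|X_t,U_t)$ (conditionally on the past); $E_P^{\gamma}$ is the corresponding expectation. For fixed $\beta\in(0,1)$, $$J_\beta(P,\mathcal{T},\gamma)=E_P^{\gamma}\Big[\sum_{t=0}^\infty\beta^tc(X_t,U_t)\Big],\qquad J_\beta^*(P,\mathcal{T})=\inf_{\gamma\in\Gamma}J_\beta(P,\mathcal{T},\gamma),$$ with $Q$ fixed. The total variation distance is $\|\mu-\nu\|_{TV}=2\sup_B|\mu(B)-\nu(B)|$ over Borel sets $B$. *)

theory Defs
  imports "HOL-Probability.Probability"
begin

abbreviation borel_of :: "'a::topological_space set \<Rightarrow> 'a measure" where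
  "borel_of S \<equiv> restrict_space borel S"

abbreviation borel_probs :: "'a::topological_space set \<Rightarrow> 'a measure set" where
  "borel_probs S \<equiv> space (prob_algebra (borel_of S))"

abbreviation stochastic_kernel :: "'a measure \<Rightarrow> 'b measure \<Rightarrow> ('a \<Rightarrow> 'b measure) \<Rightarrow> bool" where
  "stochastic_kernel M N K \<equiv> K \<in> M \<rightarrow>\<^sub>M prob_algebra N"

definition converges_weakly ::
    "'a::topological_space set \<Rightarrow> (nat \<Rightarrow> 'a measure) \<Rightarrow> 'a measure \<Rightarrow> bool" where
  "converges_weakly S \<mu>s \<mu> \<longleftrightarrow>
     (\<forall>g::'a \<Rightarrow> real. continuous_on S g \<and> bounded (g ` S) \<longrightarrow>
        (\<lambda>n. \<integral>x. g x \<partial>\<mu>s n) \<longlonglongrightarrow> (\<integral>x. g x \<partial>\<mu>))"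

definition weakly_continuous_kernel ::
    "'z::topological_space set \<Rightarrow> 'a::topological_space set \<Rightarrow> ('z \<Rightarrow> 'a measure) \<Rightarrow> bool" where
  "weakly_continuous_kernel D S K \<longleftrightarrow>
     (\<forall>g::'a \<Rightarrow> real. continuous_on S g \<and> bounded (g ` S) \<longrightarrow>
        continuous_on D (\<lambda>z. \<integral>x. g x \<partial>K z))"

definition tv_distance :: "'a measure \<Rightarrow> 'a measure \<Rightarrow> real" where
  "tv_distance \<mu> \<nu> = 2 * (SUP B\<in>sets \<mu>. \<bar>measure \<mu> B - measure \<nu> B\<bar>)"

definition tv_continuous_kernel ::
    "'a::topological_space set \<Rightarrow> ('a \<Rightarrow> 'b measure) \<Rightarrow> bool" where
  "tv_continuous_kernel S K \<longleftrightarrow>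
     (\<forall>xs x. (\<forall>n. xs n \<in> S) \<and> x \<in> S \<and> xs \<longlonglongrightarrow> x \<longrightarrow>
        (\<lambda>n. tv_distance (K (xs n)) (K x)) \<longlonglongrightarrow> 0)"

text \<open>The information \<open>I\<^sub>t\<close> is a pair of functions on \<open>{..t}\<close> (observations) and on
  \<open>{..<t}\<close> (past controls), so a policy maps a time and such a pair to a control.\<close>

type_synonym ('y, 'u) policy = "nat \<Rightarrow> (nat \<Rightarrow> 'y) \<times> (nat \<Rightarrow> 'u) \<Rightarrow> 'u"

definition info_space ::
    "'y::topological_space set \<Rightarrow> 'u::topological_space set \<Rightarrow> nat
      \<Rightarrow> ((nat \<Rightarrow> 'y) \<times> (nat \<Rightarrow> 'u)) measure" where
  "info_space Y U t = PiM {..t} (\<lambda>_. borel_of Y) \<Otimes>\<^sub>M PiM {..<t} (\<lambda>_. borel_of U)"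

definition admissible_policies ::
    "'y::topological_space set \<Rightarrow> 'u::topological_space set \<Rightarrow> ('y, 'u) policy set" where
  "admissible_policies Y U = {\<gamma>. \<forall>t. \<gamma> t \<in> info_space Y U t \<rightarrow>\<^sub>M borel_of U}"

text \<open>A path \<open>\<omega>\<close> assigns to every time \<open>t\<close> the triple \<open>(X\<^sub>t, Y\<^sub>t, U\<^sub>t)\<close>.\<close>

definition state_at :: "(nat \<Rightarrow> 'x \<times> 'y \<times> 'u) \<Rightarrow> nat \<Rightarrow> 'x" where
  "state_at \<omega> t = fst (\<omega> t)"

definition observation_at :: "(nat \<Rightarrow> 'x \<times> 'y \<times> 'u) \<Rightarrow> nat \<Rightarrow> 'y" where
  "observation_at \<omega> t = fst (snd (\<omega> t))"

definition control_at :: "(nat \<Rightarrow> 'x \<times> 'y \<times> 'u) \<Rightarrow> nat \<Rightarrow> 'u" where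
  "control_at \<omega> t = snd (snd (\<omega> t))"

definition stage_space ::
    "'x::topological_space set \<Rightarrow> 'y::topological_space set \<Rightarrow> 'u::topological_space set
      \<Rightarrow> ('x \<times> 'y \<times> 'u) measure" where
  "stage_space X Y U = borel_of X \<Otimes>\<^sub>M (borel_of Y \<Otimes>\<^sub>M borel_of U)"

text \<open>The information available at time \<open>t\<close>, given the path \<open>\<omega>\<close> up to time \<open>t - 1\<close> and the
  observation \<open>y\<close> made at time \<open>t\<close>.\<close>

definition information ::
    "nat \<Rightarrow> (nat \<Rightarrow> 'x \<times> 'y \<times> 'u) \<Rightarrow> 'y \<Rightarrow> (nat \<Rightarrow> 'y) \<times> (nat \<Rightarrow> 'u)" where
  "information t \<omega> y =
     (\<lambda>i\<in>{..t}. if i = t then y else observation_at \<omega> i, \<lambda>i\<in>{..<t}. control_at \<omega> i)"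

text \<open>The conditional law of \<open>(X\<^sub>t, Y\<^sub>t, U\<^sub>t)\<close> given the past \<open>\<omega>\<close> on \<open>{0..<t}\<close>.\<close>

definition stage_kernel ::
    "'x::topological_space set \<Rightarrow> 'y::topological_space set \<Rightarrow> 'u::topological_space set
      \<Rightarrow> ('x \<Rightarrow> 'y measure) \<Rightarrow> 'x measure \<Rightarrow> ('x \<times> 'u \<Rightarrow> 'x measure) \<Rightarrow> ('y, 'u) policy
      \<Rightarrow> nat \<Rightarrow> (nat \<Rightarrow> 'x \<times> 'y \<times> 'u) \<Rightarrow> ('x \<times> 'y \<times> 'u) measure" where
  "stage_kernel X Y U Q P T \<gamma> t \<omega> =
     (case t of 0 \<Rightarrow> P | Suc s \<Rightarrow> T (state_at \<omega> s, control_at \<omega> s)) \<bind> (\<lambda>x.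
     Q x \<bind> (\<lambda>y.
     return (stage_space X Y U) (x, y, \<gamma> t (information t \<omega> y))))"

text \<open>The law of the controlled process on path space: the Ionescu-Tulcea measure of the
  stage kernels. It has the intended finite-dimensional distributions because of
  \<open>Ionescu_Tulcea_stage_kernel\<close> below.\<close>

definition path_measure ::
    "'x::topological_space set \<Rightarrow> 'y::topological_space set \<Rightarrow> 'u::topological_space set
      \<Rightarrow> ('x \<Rightarrow> 'y measure) \<Rightarrow> 'x measure \<Rightarrow> ('x \<times> 'u \<Rightarrow> 'x measure) \<Rightarrow> ('y, 'u) policy
      \<Rightarrow> (nat \<Rightarrow> 'x \<times> 'y \<times> 'u) measure" where
  "path_measure X Y U Q P T \<gamma> =
     projective_family.lim UNIV
       (Ionescu_Tulcea.CI (stage_kernel X Y U Q P T \<gamma>) (\<lambda>_. stage_space X Y U))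
       (\<lambda>_. stage_space X Y U)"

definition discounted_cost ::
    "'x::topological_space set \<Rightarrow> 'y::topological_space set \<Rightarrow> 'u::topological_space set
      \<Rightarrow> ('x \<Rightarrow> 'y measure) \<Rightarrow> ('x \<times> 'u \<Rightarrow> real) \<Rightarrow> real
      \<Rightarrow> 'x measure \<Rightarrow> ('x \<times> 'u \<Rightarrow> 'x measure) \<Rightarrow> ('y, 'u) policy \<Rightarrow> real" where
  "discounted_cost X Y U Q c \<beta> P T \<gamma> =
     (\<integral>\<omega>. (\<Sum>t. \<beta> ^ t * c (state_at \<omega> t, control_at \<omega> t)) \<partial>path_measure X Y U Q P T \<gamma>)"

definition optimal_discounted_cost ::
    "'x::topological_space set \<Rightarrow> 'y::topological_space set \<Rightarrow> 'u::topological_space set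
      \<Rightarrow> ('x \<Rightarrow> 'y measure) \<Rightarrow> ('x \<times> 'u \<Rightarrow> real) \<Rightarrow> real
      \<Rightarrow> 'x measure \<Rightarrow> ('x \<times> 'u \<Rightarrow> 'x measure) \<Rightarrow> real" where
  "optimal_discounted_cost X Y U Q c \<beta> P T =
     (INF \<gamma>\<in>admissible_policies Y U. discounted_cost X Y U Q c \<beta> P T \<gamma>)"

lemma measurable_information:
  assumes "S = stage_space X Y U"
  shows "(\<lambda>(\<omega>, y). information t \<omega> y)
     \<in> (PiM {0..<t} (\<lambda>_. S) \<Otimes>\<^sub>M borel_of Y) \<rightarrow>\<^sub>M info_space Y U t"
proof -
  have comp: "(\<lambda>p. fst p i) \<in> (PiM {0..<t} (\<lambda>_. S) \<Otimes>\<^sub>M borel_of Y) \<rightarrow>\<^sub>M S" if "i < t" for i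
    by (rule measurable_compose[OF measurable_fst measurable_component_singleton]) (use that in simp)
  have fy: "(\<lambda>s. fst (snd s)) \<in> S \<rightarrow>\<^sub>M borel_of Y" and su: "(\<lambda>s. snd (snd s)) \<in> S \<rightarrow>\<^sub>M borel_of U"
    unfolding assms stage_space_def by measurable
  have 1: "(\<lambda>p. if i = t then snd p else fst (snd (fst p i)))
      \<in> (PiM {0..<t} (\<lambda>_. S) \<Otimes>\<^sub>M borel_of Y) \<rightarrow>\<^sub>M borel_of Y" if "i \<le> t" for i
    using that measurable_compose[OF comp fy, of i] by (cases "i = t") auto
  have 2: "(\<lambda>p. snd (snd (fst p i)))
      \<in> (PiM {0..<t} (\<lambda>_. S) \<Otimes>\<^sub>M borel_of Y) \<rightarrow>\<^sub>M borel_of U" if "i < t" for i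
    using measurable_compose[OF comp[OF that] su] .
  show ?thesis
    unfolding info_space_def information_def observation_at_def control_at_def split_beta'
    by (intro measurable_Pair measurable_restrict) (auto intro: 1 2)
qed

lemma stage_kernel_measurable:
  assumes Q: "stochastic_kernel (borel_of X) (borel_of Y) Q"
    and T: "stochastic_kernel (borel_of X \<Otimes>\<^sub>M borel_of U) (borel_of X) T"
    and P: "P \<in> borel_probs X"
    and \<gamma>: "\<gamma> \<in> admissible_policies Y U"
  shows "stage_kernel X Y U Q P T \<gamma> t
     \<in> PiM {0..<t} (\<lambda>_. stage_space X Y U) \<rightarrow>\<^sub>M prob_algebra (stage_space X Y U)"
proof -
  let ?S = "stage_space X Y U"
  let ?H = "PiM {0..<t} (\<lambda>_. ?S)"
  have xu: "(\<lambda>s. (fst s, snd (snd s))) \<in> ?S \<rightarrow>\<^sub>M (borel_of X \<Otimes>\<^sub>M borel_of U)"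
    unfolding stage_space_def by measurable
  have 1: "(\<lambda>\<omega>. case t of 0 \<Rightarrow> P | Suc s \<Rightarrow> T (state_at \<omega> s, control_at \<omega> s))
      \<in> ?H \<rightarrow>\<^sub>M prob_algebra (borel_of X)"
  proof (cases t)
    case 0
    then show ?thesis using P by simp
  next
    case (Suc s)
    have "(\<lambda>\<omega>. \<omega> s) \<in> ?H \<rightarrow>\<^sub>M ?S"
      using Suc by simp
    from measurable_compose[OF measurable_compose[OF this xu] T] show ?thesis
      using Suc by (simp add: state_at_def control_at_def)
  qed
  have g: "\<gamma> t \<in> info_space Y U t \<rightarrow>\<^sub>M borel_of U"
    using \<gamma> by (simp add: admissible_policies_def)
  have i: "(\<lambda>p. information t (fst (fst p)) (snd p))
      \<in> ((?H \<Otimes>\<^sub>M borel_of X) \<Otimes>\<^sub>M borel_of Y) \<rightarrow>\<^sub>M info_space Y U t"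
    using measurable_compose[OF _ measurable_information[OF refl],
        of "\<lambda>p. (fst (fst p), snd p)" "(?H \<Otimes>\<^sub>M borel_of X) \<Otimes>\<^sub>M borel_of Y"]
    by simp
  have "(\<lambda>p. (snd (fst p), snd p, \<gamma> t (information t (fst (fst p)) (snd p))))
      \<in> ((?H \<Otimes>\<^sub>M borel_of X) \<Otimes>\<^sub>M borel_of Y) \<rightarrow>\<^sub>M ?S"
    unfolding stage_space_def[where X=X and Y=Y and U=U]
    using measurable_compose[OF i g] unfolding stage_space_def by measurable
  from measurable_compose[OF this measurable_return_prob_space]
  have 2: "(\<lambda>p. return ?S (snd (fst p), snd p, \<gamma> t (information t (fst (fst p)) (snd p))))
      \<in> ((?H \<Otimes>\<^sub>M borel_of X) \<Otimes>\<^sub>M borel_of Y) \<rightarrow>\<^sub>M prob_algebra ?S" .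
  have 3: "(\<lambda>p. Q (snd p) \<bind> (\<lambda>y. return ?S (snd p, y, \<gamma> t (information t (fst p) y))))
      \<in> (?H \<Otimes>\<^sub>M borel_of X) \<rightarrow>\<^sub>M prob_algebra ?S"
    by (rule measurable_bind_prob_space2[OF measurable_compose[OF measurable_snd Q]])
       (use 2 in \<open>simp add: split_beta'\<close>)
  have "(\<lambda>\<omega>. stage_kernel X Y U Q P T \<gamma> t \<omega>) \<in> ?H \<rightarrow>\<^sub>M prob_algebra ?S"
    unfolding stage_kernel_def
    by (rule measurable_bind_prob_space2[OF 1]) (use 3 in \<open>simp add: split_beta'\<close>)
  then show ?thesis .
qed

lemma Ionescu_Tulcea_stage_kernel:
  assumes "stochastic_kernel (borel_of X) (borel_of Y) Q"
    and "stochastic_kernel (borel_of X \<Otimes>\<^sub>M borel_of U) (borel_of X) T"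
    and "P \<in> borel_probs X"
    and "\<gamma> \<in> admissible_policies Y U"
  shows "Ionescu_Tulcea (stage_kernel X Y U Q P T \<gamma>) (\<lambda>_. stage_space X Y U)"
proof (rule Ionescu_Tulcea.intro)
  fix t
  note K = stage_kernel_measurable[OF assms, of t]
  show "stage_kernel X Y U Q P T \<gamma> t
      \<in> PiM {0..<t} (\<lambda>_. stage_space X Y U) \<rightarrow>\<^sub>M subprob_algebra (stage_space X Y U)"
    using K by (rule measurable_prob_algebraD)
  show "prob_space (stage_kernel X Y U Q P T \<gamma> t \<omega>)"
    if "\<omega> \<in> space (PiM {0..<t} (\<lambda>_. stage_space X Y U))" for \<omega>
    using measurable_space[OF K that] by (simp add: space_prob_algebra)
qed

end

(* For every policy and stage, the expected stage cost is a function of the initial state integrated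
   against the prior. The point is that, over all policies, these functions form one bounded
   equicontinuous family F: total variation continuity of Q makes x |-> int k(x, y) Q(dy | x)
   equicontinuous when the k(., y) are, because k may depend on y in an arbitrary measurable way
   (hence through the policy), while weak continuity of T and compactness of U make
   x |-> int f dT(. | x, u) equicontinuous over u in U and f in an equicontinuous family. Weak
   convergence of the priors is uniform over F, so each stage cost converges uniformly over policies.
   Bounded costs and discounting give the same for the total cost, hence for the infimum. *)

theory Submission
  imports Defs
begin

subsection \<open>Equicontinuous families and weak convergence\<close>

text \<open>Policies are merely measurable in the history and carry no useful topology, so there is
  no limit of policies to work with; every estimate is made uniform in them instead. This is done
  backwards in time. A function of the past and of the current state is averaged over one
  observation, the control it triggers and one transition; the result is a function of the same kind
  one stage earlier and does not involve the prior. The step is an exact identity, so no error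
  accumulates, and the weak convergence of the priors enters only at time 0. The family reached
  there depends on the stage, on \<open>c\<close> and on the kernels alone. The obstacle is the
  past. Past observations and controls are harmless parameters, but measurable dependence on past
  states would turn, one stage earlier, into measurable and possibly discontinuous dependence on the
  current state. The set \<open>X\<close> is merely Borel. Hence equicontinuity is pointwise, with a
  radius for each point, and uniformity of weak convergence over such a family comes from a
  countable subcover rather than from compactness or tightness.\<close>

definition equicont_on :: "'a::metric_space set \<Rightarrow> ('a \<Rightarrow> real) set \<Rightarrow> bool" where
  "equicont_on X F \<longleftrightarrow>
     (\<forall>x\<in>X. \<forall>e>0. \<exists>d>0. \<forall>y\<in>X. dist y x < d \<longrightarrow> (\<forall>f\<in>F. \<bar>f y - f x\<bar> < e))"

lemma equicont_on_imp_continuous_on: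
  assumes "equicont_on X F" "f \<in> F"
  shows "continuous_on X f"
  using assms unfolding equicont_on_def continuous_on_iff dist_real_def by blast

lemma equicont_on_sequentiallyD:
  assumes "equicont_on X F" "x \<in> X" "\<And>n. xs n \<in> X" "xs \<longlonglongrightarrow> x" "e > 0"
  shows "\<forall>\<^sub>F n in sequentially. \<forall>f\<in>F. \<bar>f (xs n) - f x\<bar> < e"
proof -
  obtain d where d: "d > 0" "\<And>y f. y \<in> X \<Longrightarrow> dist y x < d \<Longrightarrow> f \<in> F \<Longrightarrow> \<bar>f y - f x\<bar> < e"
    using assms(1,2,5) unfolding equicont_on_def by meson
  have "\<forall>\<^sub>F n in sequentially. dist (xs n) x < d"
    using assms(4) d(1) by (simp add: tendsto_iff)
  then show ?thesis
    by eventually_elim (use d assms(3) in auto)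
qed

text \<open>A failure at \<open>x\<close> supplies, within distance \<open>1/(n+1)\<close>, a point
  and a member that violate the bound. Letting the member vary along the sequence turns uniformity
  over \<open>F\<close> into one limit, which suits subsequence arguments and the sequential form of
  continuity in total variation.\<close>

lemma equicont_on_sequentiallyI:
  assumes "\<And>x xs fs. x \<in> X \<Longrightarrow> (\<And>n. xs n \<in> X) \<Longrightarrow> (\<And>n. fs n \<in> F) \<Longrightarrow> xs \<longlonglongrightarrow> x
    \<Longrightarrow> (\<lambda>n. fs n (xs n) - fs n x) \<longlonglongrightarrow> 0"
  shows "equicont_on X F"
proof (rule ccontr)
  assume "\<not> equicont_on X F"
  then obtain x e where x: "x \<in> X" "e > 0"
    and "\<And>d. d > 0 \<Longrightarrow> \<exists>y\<in>X. dist y x < d \<and> (\<exists>f\<in>F. \<not> \<bar>f y - f x\<bar> < e)"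
    unfolding equicont_on_def by blast
  then have "\<exists>y f. y \<in> X \<and> f \<in> F \<and> dist y x < inverse (real (Suc n)) \<and> \<not> \<bar>f y - f x\<bar> < e" for n
    by (metis inverse_positive_iff_positive of_nat_0_less_iff zero_less_Suc)
  then obtain xs fs where s: "\<And>n. xs n \<in> X" "\<And>n. fs n \<in> F"
    "\<And>n. dist (xs n) x < inverse (real (Suc n))" "\<And>n. \<not> \<bar>fs n (xs n) - fs n x\<bar> < e"
    by metis
  have "(\<lambda>n. dist (xs n) x) \<longlonglongrightarrow> 0"
    by (rule tendsto_sandwich[OF _ _ tendsto_const LIMSEQ_inverse_real_of_nat])
       (auto intro!: always_eventually less_imp_le s(3) simp del: of_nat_Suc)
  then have "xs \<longlonglongrightarrow> x"
    by (simp add: tendsto_dist_iff[symmetric])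
  from assms[OF x(1) s(1,2) this] have "\<forall>\<^sub>F n in sequentially. \<bar>fs n (xs n) - fs n x\<bar> < e"
    using x(2) by (simp add: tendsto_iff)
  then show False
    using s(4) by (simp add: eventually_sequentially)
qed

section \<open>Integrals of bounded functions on a probability space\<close>

lemma borel_probsD:
  assumes "\<mu> \<in> borel_probs X"
  shows "prob_space \<mu>" "sets \<mu> = sets (borel_of X)" "space \<mu> = X"
  using assms by (auto simp: space_prob_algebra space_restrict_space dest: sets_eq_imp_space_eq)

lemma measurable_borel_probs_continuous:
  fixes f :: "'a::topological_space \<Rightarrow> real"
  assumes "\<mu> \<in> borel_probs X" "continuous_on X f"
  shows "f \<in> borel_measurable \<mu>"
  using borel_measurable_continuous_on_restrict[OF assms(2)] borel_probsD(2)[OF assms(1)]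
  by (simp cong: measurable_cong_sets)

lemma (in prob_space) integrable_of_abs_le:
  fixes f :: "'a \<Rightarrow> real"
  assumes "f \<in> borel_measurable M" "\<And>x. x \<in> space M \<Longrightarrow> \<bar>f x\<bar> \<le> B"
  shows "integrable M f"
  by (rule integrable_const_bound[of _ B]) (use assms in auto)

lemma (in prob_space) abs_integral_le:
  fixes f :: "'a \<Rightarrow> real"
  assumes "f \<in> borel_measurable M" "\<And>x. x \<in> space M \<Longrightarrow> \<bar>f x\<bar> \<le> B"
  shows "\<bar>\<integral>x. f x \<partial>M\<bar> \<le> B"
proof -
  have i: "integrable M f"
    using assms by (rule integrable_of_abs_le)
  have "integral\<^sup>L M f \<le> B" "- B \<le> integral\<^sup>L M f"
    using assms(2) by (auto intro!: integral_le_const integral_ge_const i AE_I2 simp: abs_le_iff minus_le_iff)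
  then show ?thesis by auto
qed

text \<open>Cover \<open>X\<close> by countably many balls on which no member of \<open>F\<close> oscillates by \<open>e/8\<close> or more,
  with bump functions \<open>b i\<close>. The weights \<open>w i = b i * (\<Prod>j<i. 1 - b j)\<close> satisfy
  \<open>(\<Sum>i<N. w i) = 1 - p N\<close> with \<open>\<integral>p N \<partial>\<mu>\<close> small for large \<open>N\<close>, so all \<open>f \<in> F\<close> are tested
  simultaneously by finitely many bounded continuous functions.\<close>

lemma converges_weakly_uniform:
  fixes X :: "'a::{metric_space, second_countable_topology} set"
  assumes F: "equicont_on X F" "0 \<le> M" "\<And>f x. f \<in> F \<Longrightarrow> x \<in> X \<Longrightarrow> \<bar>f x\<bar> \<le> M"
    and \<mu>s: "\<And>n. \<mu>s n \<in> borel_probs X" and \<mu>: "\<mu> \<in> borel_probs X"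
    and conv: "converges_weakly X \<mu>s \<mu>" and "e > 0"
  shows "\<forall>\<^sub>F n in sequentially. \<forall>f\<in>F. \<bar>(\<integral>x. f x \<partial>\<mu>s n) - (\<integral>x. f x \<partial>\<mu>)\<bar> < e"
proof -
  interpret \<mu>: prob_space \<mu> by (rule borel_probsD[OF \<mu>])
  note sp = borel_probsD(3)
  \<comment> \<open>The total error is \<open>5 * d\<close>: \<open>2 * d\<close> for replacing
    \<open>f\<close> by its finite combination under each of the two measures, and \<open>d\<close>
    for comparing the combinations.\<close>
  define d where "d = e / 8"
  have d: "d > 0" using \<open>e > 0\<close> by (simp add: d_def)
  have "\<exists>r>0. \<forall>y\<in>X. dist y x < r \<longrightarrow> (\<forall>f\<in>F. \<bar>f y - f x\<bar> < d)" if "x \<in> X" for x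
    using F(1) that d unfolding equicont_on_def by blast
  then obtain r where r: "\<And>x. x \<in> X \<Longrightarrow> r x > 0"
    "\<And>x y f. x \<in> X \<Longrightarrow> y \<in> X \<Longrightarrow> dist y x < r x \<Longrightarrow> f \<in> F \<Longrightarrow> \<bar>f y - f x\<bar> < d"
    by metis
  have "X \<noteq> {}" using \<mu>.not_empty sp[OF \<mu>] by simp
  obtain \<C> where \<C>: "\<C> \<subseteq> (\<lambda>x. ball x (r x / 2)) ` X" "countable \<C>"
    "\<Union>\<C> = \<Union>((\<lambda>x. ball x (r x / 2)) ` X)"
    by (rule Lindelof[of "(\<lambda>x. ball x (r x / 2)) ` X"]) auto
  obtain D where D: "countable D" "D \<subseteq> X" "\<C> = (\<lambda>x. ball x (r x / 2)) ` D"
    using \<C>(1,2) countable_subset_image by meson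
  have cover: "X \<subseteq> (\<Union>x\<in>D. ball x (r x / 2))"
    using \<C>(3) D(3) r(1) by force
  with \<open>X \<noteq> {}\<close> have "D \<noteq> {}" by auto
  define z where "z = from_nat_into D"
  have zX: "z i \<in> X" for i
    using from_nat_into[OF \<open>D \<noteq> {}\<close>] D(2) by (auto simp: z_def)
  have zc: "\<exists>i. dist y (z i) < r (z i) / 2" if "y \<in> X" for y
    using cover that from_nat_into_surj[OF D(1)] unfolding z_def
    by (force simp: dist_commute)
  \<comment> \<open>A tent equal to 1 on the ball of half radius and 0 off the full ball. The half
    balls already cover \<open>X\<close>, so every point has some \<open>b i\<close> equal to 1 and
    the product \<open>p\<close> vanishes there from some index on.\<close>
  define b where "b i y = min 1 (max 0 (2 - 2 * dist y (z i) / r (z i)))" for i y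
  define p where "p N y = (\<Prod>i<N. 1 - b i y)" for N y
  define w where "w i y = b i y * p i y" for i y
  have b01: "0 \<le> b i y" "b i y \<le> 1" for i y by (auto simp: b_def)
  have p01: "0 \<le> p N y" "p N y \<le> 1" for N y
    using b01 by (auto simp: p_def intro!: prod_nonneg prod_le_1)
  have w01: "0 \<le> w i y" "w i y \<le> 1" for i y
    using b01 p01 by (auto simp: w_def mult_le_one)
  have sum_w: "(\<Sum>i<N. w i y) = 1 - p N y" for N y
    by (induction N) (auto simp: p_def w_def algebra_simps)
  have b0: "b i y = 0" if "\<not> dist y (z i) < r (z i)" for i y
    using that r(1)[OF zX[of i]] by (auto simp: b_def field_simps)
  have b1: "b i y = 1" if "dist y (z i) < r (z i) / 2" for i y
    using that r(1)[OF zX[of i]] by (auto simp: b_def field_simps)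
  have cb: "continuous_on X (b i)" for i
    unfolding b_def[abs_def] using r(1)[OF zX[of i]] by (intro continuous_intros) auto
  have cp: "continuous_on X (p N)" for N
    unfolding p_def[abs_def] by (intro continuous_intros cb)
  have cw: "continuous_on X (w N)" for N
    unfolding w_def[abs_def] by (intro continuous_intros cb cp)
  have lim: "(\<lambda>n. \<integral>y. g y \<partial>\<mu>s n) \<longlonglongrightarrow> (\<integral>y. g y \<partial>\<mu>)"
    if "continuous_on X g" "\<And>y. 0 \<le> g y" "\<And>y. g y \<le> 1" for g :: "'a \<Rightarrow> real"
  proof -
    have "bounded (g ` X)"
      unfolding bounded_iff using that(2,3) by (intro exI[of _ 1]) auto
    then show ?thesis using conv that(1) unfolding converges_weakly_def by blast
  qed
  have "(\<lambda>N. \<integral>y. p N y \<partial>\<mu>) \<longlonglongrightarrow> (\<integral>y. 0 \<partial>\<mu>)"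
  proof (rule integral_dominated_convergence[where w="\<lambda>_. 1"])
    show "AE y in \<mu>. (\<lambda>N. p N y) \<longlonglongrightarrow> 0"
    proof (rule AE_I2)
      fix y assume "y \<in> space \<mu>"
      then obtain i where i: "dist y (z i) < r (z i) / 2" using zc sp[OF \<mu>] by auto
      have "p N y = 0" if "N \<ge> Suc i" for N
        unfolding p_def using b1[OF i] that by (auto intro!: prod_zero bexI[of _ i])
      then show "(\<lambda>N. p N y) \<longlonglongrightarrow> 0"
        by (intro tendsto_eventually) (auto simp: eventually_sequentially)
    qed
  qed (use p01 measurable_borel_probs_continuous[OF \<mu> cp] in auto)
  \<comment> \<open>The denominator \<open>M + 1\<close> gives \<open>M * (d / (M + 1)) < d\<close>
    and also covers \<open>M = 0\<close>.\<close>
  then have "\<forall>\<^sub>F N in sequentially. (\<integral>y. p N y \<partial>\<mu>) < d / (M + 1)"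
    using order_tendstoD(2)[of _ 0 _ "d / (M + 1)"] d F(2) by simp
  then obtain N where N: "(\<integral>y. p N y \<partial>\<mu>) < d / (M + 1)"
    by (auto simp: eventually_sequentially)
  have small: "\<bar>(\<integral>x. f x \<partial>\<nu>) - (\<Sum>i<N. f (z i) * (\<integral>x. w i x \<partial>\<nu>))\<bar> < 2 * d"
    if \<nu>: "\<nu> \<in> borel_probs X" "(\<integral>y. p N y \<partial>\<nu>) < d / (M + 1)" and f: "f \<in> F" for \<nu> f
  proof -
    interpret \<nu>: prob_space \<nu> by (rule borel_probsD[OF \<nu>(1)])
    note [measurable] = measurable_borel_probs_continuous[OF \<nu>(1)]
    have fi: "integrable \<nu> f"
      using F(3)[OF f] equicont_on_imp_continuous_on[OF F(1) f] sp[OF \<nu>(1)]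
      by (intro \<nu>.integrable_of_abs_le[of _ M]) auto
    have wi: "integrable \<nu> (w i)" for i
      using w01 cw by (intro \<nu>.integrable_of_abs_le[of _ 1]) auto
    have pi: "integrable \<nu> (p N)"
      using p01 cp by (intro \<nu>.integrable_of_abs_le[of _ 1]) auto
    \<comment> \<open>Split \<open>f y\<close> along \<open>1 = p N y + (\<Sum>i<N. w i y)\<close>.
      The part left uncovered costs at most \<open>M * p N y\<close>; every other term vanishes
      unless \<open>y\<close> lies in the ball around \<open>z i\<close>, where \<open>f\<close>
      differs from \<open>f (z i)\<close> by less than \<open>d\<close>.\<close>
    have pt: "\<bar>f y - (\<Sum>i<N. f (z i) * w i y)\<bar> \<le> M * p N y + d" if "y \<in> X" for y
    proof -
      have le: "\<bar>w i y * (f y - f (z i))\<bar> \<le> w i y * d" for i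
      proof (cases "dist y (z i) < r (z i)")
        case True
        then show ?thesis
          using r(2)[OF zX that True f] w01 by (auto simp: abs_mult intro!: mult_left_mono)
      qed (simp add: w_def b0)
      have "f y - (\<Sum>i<N. f (z i) * w i y) = f y * p N y + (\<Sum>i<N. w i y * (f y - f (z i)))"
      proof -
        have "(\<Sum>i<N. w i y * (f y - f (z i))) = (\<Sum>i<N. w i y) * f y - (\<Sum>i<N. f (z i) * w i y)"
          by (simp add: right_diff_distrib sum_subtractf sum_distrib_right mult.commute sum_distrib_left)
        then show ?thesis by (simp add: sum_w algebra_simps)
      qed
      also have "\<bar>\<dots>\<bar> \<le> M * p N y + (\<Sum>i<N. w i y * d)"
        using F(3)[OF f that] p01[of N y] le
        by (intro order.trans[OF abs_triangle_ineq] add_mono order.trans[OF sum_abs] sum_mono)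
           (auto simp: abs_mult intro: mult_right_mono)
      also have "(\<Sum>i<N. w i y * d) \<le> d"
        unfolding sum_distrib_right[symmetric] sum_w using d p01[of N y] by (simp add: algebra_simps)
      finally show ?thesis by simp
    qed
    have "(\<integral>x. f x \<partial>\<nu>) - (\<Sum>i<N. f (z i) * (\<integral>x. w i x \<partial>\<nu>)) =
      (\<integral>x. f x - (\<Sum>i<N. f (z i) * w i x) \<partial>\<nu>)"
      using fi wi by simp
    also have "\<bar>\<dots>\<bar> \<le> (\<integral>x. M * p N x + d \<partial>\<nu>)"
      using fi wi pi pt sp[OF \<nu>(1)]
      by (intro order.trans[OF integral_abs_bound] integral_mono) auto
    also have "\<dots> = M * (\<integral>x. p N x \<partial>\<nu>) + d"
      using pi by (simp add: \<nu>.prob_space)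
    also have "M * (\<integral>x. p N x \<partial>\<nu>) \<le> M * (d / (M + 1))"
      using \<nu>(2) F(2) by (intro mult_left_mono) auto
    also have "M * (d / (M + 1)) < d"
      using F(2) d by (simp add: field_simps)
    finally show ?thesis by simp
  qed
  \<comment> \<open>The single function \<open>p N\<close> is bounded and continuous, so the
    smallness of the uncovered mass passes from the limit to the approximating measures. This does
    the work of tightness.\<close>
  have ev1: "\<forall>\<^sub>F n in sequentially. (\<integral>y. p N y \<partial>\<mu>s n) < d / (M + 1)"
    using order_tendstoD(2)[OF lim[OF cp p01] N] .
  have "(\<lambda>n. M * (\<Sum>i<N. \<bar>(\<integral>x. w i x \<partial>\<mu>s n) - (\<integral>x. w i x \<partial>\<mu>)\<bar>)) \<longlonglongrightarrow>
      M * (\<Sum>i<N. \<bar>(\<integral>x. w i x \<partial>\<mu>) - (\<integral>x. w i x \<partial>\<mu>)\<bar>)"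
    by (intro tendsto_intros lim cw w01)
  then have ev2: "\<forall>\<^sub>F n in sequentially.
      M * (\<Sum>i<N. \<bar>(\<integral>x. w i x \<partial>\<mu>s n) - (\<integral>x. w i x \<partial>\<mu>)\<bar>) < d"
    using order_tendstoD(2) d by fastforce
  from ev1 ev2 show ?thesis
  proof eventually_elim
    case (elim n)
    show ?case
    proof
      fix f assume f: "f \<in> F"
      let ?S = "\<lambda>\<nu>. \<Sum>i<N. f (z i) * (\<integral>x. w i x \<partial>\<nu>)"
      have "\<bar>?S (\<mu>s n) - ?S \<mu>\<bar> = \<bar>\<Sum>i<N. f (z i) * ((\<integral>x. w i x \<partial>\<mu>s n) - (\<integral>x. w i x \<partial>\<mu>))\<bar>"
        by (simp add: right_diff_distrib sum_subtractf)
      also have "\<dots> \<le> (\<Sum>i<N. M * \<bar>(\<integral>x. w i x \<partial>\<mu>s n) - (\<integral>x. w i x \<partial>\<mu>)\<bar>)"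
        using F(3)[OF f zX]
        by (intro order.trans[OF sum_abs] sum_mono) (auto simp: abs_mult intro: mult_right_mono)
      also have "\<dots> < d" using elim(2) by (simp add: sum_distrib_left)
      finally show "\<bar>(\<integral>x. f x \<partial>\<mu>s n) - (\<integral>x. f x \<partial>\<mu>)\<bar> < e"
        using small[OF \<mu>s elim(1) f] small[OF \<mu> N f] d unfolding d_def by linarith
    qed
  qed
qed

text \<open>\<open>f\<close> is within \<open>1/m\<close> of the average of the indicators of the level sets \<open>{m * f \<ge> k}\<close>,
  \<open>1 \<le> k \<le> m\<close>.\<close>

lemma integral_diff_le_of_measure_diff_le:
  fixes f :: "'a \<Rightarrow> real"
  assumes "prob_space \<mu>" "prob_space \<nu>" and s: "sets \<nu> = sets \<mu>"
    and f: "f \<in> borel_measurable \<mu>" and f01: "\<And>x. x \<in> space \<mu> \<Longrightarrow> 0 \<le> f x \<and> f x \<le> 1"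
    and le: "\<And>B. B \<in> sets \<mu> \<Longrightarrow> \<bar>measure \<mu> B - measure \<nu> B\<bar> \<le> d"
  shows "\<bar>(\<integral>x. f x \<partial>\<mu>) - (\<integral>x. f x \<partial>\<nu>)\<bar> \<le> d"
proof -
  interpret \<mu>: prob_space \<mu> by fact
  interpret \<nu>: prob_space \<nu> by fact
  note [measurable] = f
  \<comment> \<open>The factor 2 counts one discretisation error for each of the two
    measures.\<close>
  have "\<bar>(\<integral>x. f x \<partial>\<mu>) - (\<integral>x. f x \<partial>\<nu>)\<bar> \<le> d + 2 * inverse (real (Suc n))" for n
  proof -
    define m where "m = Suc n"
    have m0: "0 < real m" by (simp add: m_def)
    define A where "A k = {x \<in> space \<mu>. real k \<le> m * f x}" for k
    have A[measurable]: "A k \<in> sets \<mu>" "A k \<in> sets \<nu>" for k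
      unfolding s by (auto simp: A_def)
    define g where "g x = (\<Sum>k=1..m. indicator (A k) x) / real m" for x
    \<comment> \<open>Counting the \<open>k\<close> between 1 and \<open>m\<close> that are at most
      \<open>m * f x\<close> gives the floor of \<open>m * f x\<close>, because \<open>f x\<close>
      lies in the unit interval.\<close>
    have g: "0 \<le> f x - g x" "f x - g x \<le> inverse m" if "x \<in> space \<mu>" for x
    proof -
      have "(\<Sum>k=1..m. indicator (A k) x) = (\<Sum>k\<in>{k\<in>{1..m}. real k \<le> m * f x}. 1::real)"
        unfolding sum.inter_filter[OF finite_atLeastAtMost] using that
        by (intro sum.cong) (auto simp: A_def)
      also have "{k\<in>{1..m}. real k \<le> m * f x} = {1..nat \<lfloor>m * f x\<rfloor>}"
      proof -
        have "real k \<le> m" if "real k \<le> m * f x" for k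
          using that f01[OF \<open>x \<in> space \<mu>\<close>] mult_left_le[of "f x" "real m"] by linarith
        then show ?thesis
          using f01[OF that] by (auto simp: le_nat_iff le_floor_iff)
      qed
      finally have "m * g x = real_of_int \<lfloor>m * f x\<rfloor>"
        using f01[OF that] by (simp add: g_def m_def)
      then have "0 \<le> m * (f x - g x)" "m * (f x - g x) \<le> 1"
        by (simp_all add: right_diff_distrib) linarith+
      then show "0 \<le> f x - g x" "f x - g x \<le> inverse m"
        using m0 by (simp_all add: zero_le_mult_iff inverse_eq_divide pos_le_divide_eq mult.commute)
    qed
    have close: "\<bar>(\<integral>x. f x \<partial>\<rho>) - (\<Sum>k=1..m. measure \<rho> (A k)) / m\<bar> \<le> inverse m"
      if "prob_space \<rho>" "sets \<rho> = sets \<mu>" for \<rho>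
    proof -
      interpret \<rho>: prob_space \<rho> by fact
      have sp: "space \<rho> = space \<mu>" using that(2) by (rule sets_eq_imp_space_eq)
      have [measurable]: "f \<in> borel_measurable \<rho>" "\<And>k. A k \<in> sets \<rho>"
        using f that(2) by (simp_all cong: measurable_cong_sets)
      have fi: "integrable \<rho> f"
        using f01 sp by (intro \<rho>.integrable_of_abs_le[of _ 1]) auto
      have [simp]: "A k \<inter> space \<mu> = A k" for k by (auto simp: A_def)
      have gi: "integrable \<rho> g" 
        unfolding g_def[abs_def]
        by (intro integrable_divide Bochner_Integration.integrable_sum \<rho>.integrable_of_abs_le[of _ 1])
           (auto simp: indicator_def)
      have "(\<integral>x. g x \<partial>\<rho>) = (\<Sum>k=1..m. measure \<rho> (A k)) / m"
        unfolding g_def by (simp add: sp Bochner_Integration.integral_sum less_top[symmetric])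
      then have "(\<integral>x. f x \<partial>\<rho>) - (\<Sum>k=1..m. measure \<rho> (A k)) / m = (\<integral>x. f x - g x \<partial>\<rho>)"
        using fi gi by simp
      also have "\<bar>\<dots>\<bar> \<le> inverse m"
        using fi gi g sp by (intro \<rho>.abs_integral_le) auto
      finally show ?thesis .
    qed
    have "\<bar>(\<Sum>k=1..m. measure \<mu> (A k)) / m - (\<Sum>k=1..m. measure \<nu> (A k)) / m\<bar> =
      \<bar>\<Sum>k=1..m. measure \<mu> (A k) - measure \<nu> (A k)\<bar> / m"
      by (simp add: diff_divide_distrib[symmetric] sum_subtractf)
    also have "\<dots> \<le> (\<Sum>k=1..m. d) / m"
      by (intro divide_right_mono order.trans[OF sum_abs] sum_mono le) auto
    also have "\<dots> = d" by (simp add: m_def)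
    finally show ?thesis
      using close[OF assms(1) refl] close[OF assms(2) s] by (simp add: m_def)
  qed
  moreover have "(\<lambda>n. d + 2 * inverse (real (Suc n))) \<longlonglongrightarrow> d + 2 * 0"
    by (intro tendsto_intros LIMSEQ_inverse_real_of_nat)
  ultimately show ?thesis
    using LIMSEQ_le_const[of "\<lambda>n. d + 2 * inverse (real (Suc n))" "d + 2 * 0"
        "\<bar>(\<integral>x. f x \<partial>\<mu>) - (\<integral>x. f x \<partial>\<nu>)\<bar>"] by auto
qed

text \<open>The map \<open>(f + M) / (2 * M)\<close> carries the range of \<open>f\<close> into the
  unit interval and divides the difference of the integrals by \<open>2 * M\<close>. Undoing it
  costs the factor 2 that is built into \<open>tv_distance\<close>. The rescaling forces
  \<open>M = 0\<close> to be treated separately.\<close>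

lemma abs_integral_diff_le_tv_distance:
  fixes f :: "'a \<Rightarrow> real"
  assumes "prob_space \<mu>" "prob_space \<nu>" and s: "sets \<nu> = sets \<mu>"
    and f: "f \<in> borel_measurable \<mu>" and fM: "\<And>x. x \<in> space \<mu> \<Longrightarrow> \<bar>f x\<bar> \<le> M"
  shows "\<bar>(\<integral>x. f x \<partial>\<mu>) - (\<integral>x. f x \<partial>\<nu>)\<bar> \<le> M * tv_distance \<mu> \<nu>"
proof -
  interpret \<mu>: prob_space \<mu> by fact
  interpret \<nu>: prob_space \<nu> by fact
  have sp: "space \<nu> = space \<mu>" using s by (rule sets_eq_imp_space_eq)
  have f': "f \<in> borel_measurable \<nu>" using f s by (simp cong: measurable_cong_sets)
  have i: "integrable \<mu> f" "integrable \<nu> f"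
    using fM sp f f' by (auto intro: \<mu>.integrable_of_abs_le \<nu>.integrable_of_abs_le)
  have M: "0 \<le> M" using fM \<mu>.not_empty by (meson abs_ge_zero ex_in_conv order_trans)
  define S where "S = (SUP B\<in>sets \<mu>. \<bar>measure \<mu> B - measure \<nu> B\<bar>)"
  have S: "\<bar>measure \<mu> B - measure \<nu> B\<bar> \<le> S" if "B \<in> sets \<mu>" for B
    unfolding S_def
  proof (rule cSUP_upper[OF that])
    have "\<bar>measure \<mu> B - measure \<nu> B\<bar> \<le> 1" for B
      using \<mu>.prob_le_1[of B] \<nu>.prob_le_1[of B] measure_nonneg[of \<mu> B] measure_nonneg[of \<nu> B]
      by linarith
    then show "bdd_above ((\<lambda>B. \<bar>measure \<mu> B - measure \<nu> B\<bar>) ` sets \<mu>)"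
      by (intro bdd_aboveI[of _ 1]) auto
  qed
  show ?thesis
  proof (cases "M = 0")
    case True
    then have "(\<integral>x. f x \<partial>\<mu>) = (\<integral>x. 0 \<partial>\<mu>)" "(\<integral>x. f x \<partial>\<nu>) = (\<integral>x. 0 \<partial>\<nu>)"
      using fM sp by (intro Bochner_Integration.integral_cong; simp)+
    then show ?thesis using True by simp
  next
    case False
    with M have M: "M > 0" by simp
    have b: "0 \<le> (f x + M) / (2 * M) \<and> (f x + M) / (2 * M) \<le> 1" if "x \<in> space \<mu>" for x
      using fM[OF that] M by (auto simp: field_simps abs_le_iff)
    have "\<bar>(\<integral>x. (f x + M) / (2 * M) \<partial>\<mu>) - (\<integral>x. (f x + M) / (2 * M) \<partial>\<nu>)\<bar> \<le> S"
      by (rule integral_diff_le_of_measure_diff_le[OF assms(1,2) s _ b S]) (use f in auto)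
    also have "(\<integral>x. (f x + M) / (2 * M) \<partial>\<mu>) - (\<integral>x. (f x + M) / (2 * M) \<partial>\<nu>) =
        ((\<integral>x. f x \<partial>\<mu>) - (\<integral>x. f x \<partial>\<nu>)) / (2 * M)"
      using i by (simp add: \<mu>.prob_space \<nu>.prob_space diff_divide_distrib add_divide_distrib)
    finally show ?thesis
      using M by (simp add: tv_distance_def S_def[symmetric] abs_divide field_simps)
  qed
qed

text \<open>Needed because controls in a compact set converge only along subsequences. If the limit
  failed, some subsequence would stay away from 0, and so would all of its subsequences.\<close>

lemma tendsto_zero_of_subseq:
  fixes a :: "nat \<Rightarrow> real"
  assumes "\<And>r::nat \<Rightarrow> nat. strict_mono r \<Longrightarrow> \<exists>s. strict_mono s \<and> (\<lambda>n. a (r (s n))) \<longlonglongrightarrow> 0"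
  shows "a \<longlonglongrightarrow> 0"
proof (rule ccontr)
  assume "\<not> a \<longlonglongrightarrow> 0"
  then obtain e where e: "e > 0" "\<exists>\<^sub>F n in sequentially. \<not> \<bar>a n\<bar> < e"
    by (auto simp: tendsto_iff not_eventually)
  then obtain r :: "nat \<Rightarrow> nat" where r: "strict_mono r" "\<And>n. \<not> \<bar>a (r n)\<bar> < e"
    using infinite_enumerate[of "{n. \<not> \<bar>a n\<bar> < e}"]
    by (auto simp: cofinite_eq_sequentially[symmetric] frequently_cofinite)
  obtain s where "(\<lambda>n. a (r (s n))) \<longlonglongrightarrow> 0" using assms[OF r(1)] by auto
  then have "\<forall>\<^sub>F n in sequentially. \<bar>a (r (s n))\<bar> < e"
    using e(1) by (simp add: tendsto_iff)
  then show False using r(2) by (simp add: eventually_sequentially)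
qed

subsection \<open>Kernels preserve equicontinuity\<close>

lemma kernel_space:
  assumes "stochastic_kernel M (borel_of S) K" "z \<in> space M"
  shows "K z \<in> borel_probs S"
  using measurable_space[OF assms] .

text \<open>The observation \<open>y\<close> selects a member of \<open>G\<close>, and
  \<open>k x y\<close> is its value at \<open>x\<close>. In the applications the selector is the
  policy with the earlier history frozen.\<close>

definition mixtures ::
    "'a::topological_space set \<Rightarrow> 'b::topological_space set \<Rightarrow> ('a \<Rightarrow> 'b measure)
      \<Rightarrow> ('a \<Rightarrow> real) set \<Rightarrow> ('a \<Rightarrow> real) set" where
  "mixtures X Y Q G = {\<lambda>x. \<integral>y. k x y \<partial>Q x | k.
     (\<forall>y\<in>Y. (\<lambda>x. k x y) \<in> G) \<and> (\<forall>x\<in>X. k x \<in> borel_measurable (borel_of Y))}"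

lemma mixtures_bound:
  assumes Q: "stochastic_kernel (borel_of X) (borel_of Y) Q"
    and bound: "\<And>g x. g \<in> G \<Longrightarrow> x \<in> X \<Longrightarrow> \<bar>g x\<bar> \<le> M"
    and f: "f \<in> mixtures X Y Q G" and x: "x \<in> X"
  shows "\<bar>f x\<bar> \<le> M"
proof -
  obtain k where k: "f = (\<lambda>x. \<integral>y. k x y \<partial>Q x)" "\<And>y. y \<in> Y \<Longrightarrow> (\<lambda>x. k x y) \<in> G"
    "\<And>x. x \<in> X \<Longrightarrow> k x \<in> borel_measurable (borel_of Y)"
    using f unfolding mixtures_def by blast
  have Qx: "Q x \<in> borel_probs Y"
    using Q x by (intro kernel_space) (auto simp: space_restrict_space)
  interpret prob_space "Q x" by (rule borel_probsD[OF Qx])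
  show ?thesis unfolding k(1)
    using bound[OF k(2) x] k(3)[OF x] borel_probsD[OF Qx]
    by (intro abs_integral_le) (auto cong: measurable_cong_sets)
qed

text \<open>Moving from \<open>xs n\<close> to \<open>x\<close> is split in two. First the integrand
  moves under the fixed measure \<open>Q (xs n)\<close>, controlled by equicontinuity of
  \<open>G\<close> for all \<open>y\<close> at once. Then the measure moves under the fixed
  integrand \<open>k n x\<close>, which is only bounded and measurable, so the total variation bound
  applies with a constant independent of \<open>k\<close>.\<close>

lemma equicont_on_mixtures:
  assumes Q: "stochastic_kernel (borel_of X) (borel_of Y) Q"
    and tv: "tv_continuous_kernel X Q"
    and G: "equicont_on X G" and M: "\<And>g x. g \<in> G \<Longrightarrow> x \<in> X \<Longrightarrow> \<bar>g x\<bar> \<le> M"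
  shows "equicont_on X (mixtures X Y Q G)"
proof (rule equicont_on_sequentiallyI)
  fix x and xs fs :: "nat \<Rightarrow> _"
  assume x: "x \<in> X" and xs: "\<And>n. xs n \<in> X" and fs: "\<And>n. fs n \<in> mixtures X Y Q G"
    and lim: "xs \<longlonglongrightarrow> x"
  have "\<exists>k. fs n = (\<lambda>x. \<integral>y. k x y \<partial>Q x) \<and> (\<forall>y\<in>Y. (\<lambda>x. k x y) \<in> G) \<and>
      (\<forall>x\<in>X. k x \<in> borel_measurable (borel_of Y))" for n
    using fs[of n] unfolding mixtures_def by blast
  then obtain k where k: "\<And>n. fs n = (\<lambda>x. \<integral>y. k n x y \<partial>Q x)"
    "\<And>n y. y \<in> Y \<Longrightarrow> (\<lambda>x. k n x y) \<in> G"
    "\<And>n x. x \<in> X \<Longrightarrow> k n x \<in> borel_measurable (borel_of Y)"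
    by metis
  have Qp: "Q x \<in> borel_probs Y" if "x \<in> X" for x
    using Q that by (intro kernel_space) (auto simp: space_restrict_space)
  note Qs = borel_probsD[OF Qp]
  have tv0: "(\<lambda>n. M * tv_distance (Q (xs n)) (Q x)) \<longlonglongrightarrow> 0"
    using tv x xs lim unfolding tv_continuous_kernel_def by (intro tendsto_mult_right_zero) blast
  show "(\<lambda>n. fs n (xs n) - fs n x) \<longlonglongrightarrow> 0"
    unfolding tendsto_iff
  proof (intro allI impI)
    fix e :: real assume "e > 0"
    have ev1: "\<forall>\<^sub>F n in sequentially. \<forall>g\<in>G. \<bar>g (xs n) - g x\<bar> < e / 2"
      using equicont_on_sequentiallyD[OF G x xs lim, of "e / 2"] \<open>e > 0\<close> by simp
    have ev2: "\<forall>\<^sub>F n in sequentially. M * tv_distance (Q (xs n)) (Q x) < e / 2"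
      using order_tendstoD(2)[OF tv0, of "e / 2"] \<open>e > 0\<close> by simp
    from ev1 ev2 show "\<forall>\<^sub>F n in sequentially. dist (fs n (xs n) - fs n x) 0 < e"
    proof eventually_elim
      case (elim n)
      interpret Qn: prob_space "Q (xs n)" by (rule Qs[OF xs])
      have [measurable]: "k n x \<in> borel_measurable (Q (xs n))" "k n (xs n) \<in> borel_measurable (Q (xs n))"
        using k(3)[OF x, of n] k(3)[OF xs[of n], of n] Qs(2)[OF xs] by (simp_all cong: measurable_cong_sets)
      have i: "integrable (Q (xs n)) (k n x)" "integrable (Q (xs n)) (k n (xs n))"
        using M[OF k(2)] x xs Qs(3)[OF xs] by (auto intro!: Qn.integrable_of_abs_le[of _ M])
      have "fs n (xs n) - fs n x = (\<integral>y. k n (xs n) y - k n x y \<partial>Q (xs n))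
          + ((\<integral>y. k n x y \<partial>Q (xs n)) - (\<integral>y. k n x y \<partial>Q x))"
        using i by (simp add: k(1))
      moreover have "\<bar>\<integral>y. k n (xs n) y - k n x y \<partial>Q (xs n)\<bar> \<le> e / 2"
        using elim(1) k(2) Qs(3)[OF xs] by (intro Qn.abs_integral_le) (auto intro!: less_imp_le)
      moreover have "\<bar>(\<integral>y. k n x y \<partial>Q (xs n)) - (\<integral>y. k n x y \<partial>Q x)\<bar> \<le> M * tv_distance (Q (xs n)) (Q x)"
        using M[OF k(2) x] x xs Qs
        by (intro abs_integral_diff_le_tv_distance) auto
      ultimately show ?case using elim(2) by (simp add: dist_real_def)
    qed
  qed
qed

text \<open>Along a subsequence the controls converge to some \<open>u\<close> in \<open>U\<close>,
  and both \<open>c (xs n, us n)\<close> and \<open>c (x, us n)\<close> then tend to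
  \<open>c (x, u)\<close>. Continuity at the single point \<open>(x, u)\<close> suffices, which
  matters as \<open>X\<close> need not be compact.\<close>

lemma equicont_on_compact_parameter:
  fixes c :: "'a::metric_space \<times> 'b::metric_space \<Rightarrow> real"
  assumes "compact U" "continuous_on (X \<times> U) c"
  shows "equicont_on X ((\<lambda>u x. c (x, u)) ` U)"
proof (rule equicont_on_sequentiallyI)
  fix x and xs fs :: "nat \<Rightarrow> _"
  assume x: "x \<in> X" and xs: "\<And>n. xs n \<in> X" and fs: "\<And>n. fs n \<in> (\<lambda>u x. c (x, u)) ` U"
    and lim: "xs \<longlonglongrightarrow> x"
  obtain us where us: "\<And>n. us n \<in> U" "\<And>n. fs n = (\<lambda>x. c (x, us n))"
    using fs unfolding image_iff by metis
  show "(\<lambda>n. fs n (xs n) - fs n x) \<longlonglongrightarrow> 0"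
  proof (rule tendsto_zero_of_subseq)
    fix r :: "nat \<Rightarrow> nat" assume r: "strict_mono r"
    obtain u s where s: "u \<in> U" "strict_mono s" "((us \<circ> r) \<circ> s) \<longlonglongrightarrow> u"
      using seq_compactE[OF compact_imp_seq_compact[OF assms(1)], of "us \<circ> r"] us(1) by auto
    have xl: "(\<lambda>n. xs (r (s n))) \<longlonglongrightarrow> x"
      using LIMSEQ_subseq_LIMSEQ[OF LIMSEQ_subseq_LIMSEQ[OF lim r] s(2)] by (simp add: o_def)
    have ul: "(\<lambda>n. us (r (s n))) \<longlonglongrightarrow> u" using s(3) by (simp add: o_def)
    have "(\<lambda>n. c (xs (r (s n)), us (r (s n))) - c (x, us (r (s n)))) \<longlonglongrightarrow> c (x, u) - c (x, u)"
      by (intro tendsto_diff continuous_on_tendsto_compose[OF assms(2)] tendsto_Pair xl ul tendsto_const)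
         (use x xs us(1) s(1) in auto)
    then show "\<exists>s. strict_mono s \<and> (\<lambda>n. fs (r (s n)) (xs (r (s n))) - fs (r (s n)) x) \<longlonglongrightarrow> 0"
      using s(2) us(2) by auto
  qed
qed

text \<open>Controls and continuations \<open>f\<close> range over one joint family because, after
  an observation, the policy determines both.\<close>

definition transition_averages :: "'u set \<Rightarrow> ('x \<times> 'u \<Rightarrow> 'x measure) \<Rightarrow> ('x \<Rightarrow> real) set \<Rightarrow> ('x \<Rightarrow> real) set" where
  "transition_averages U T F = {\<lambda>x. \<integral>z. f z \<partial>T (x, u) | u f. u \<in> U \<and> f \<in> F}"

lemma transition_kernel_space:
  assumes "stochastic_kernel (borel_of X \<Otimes>\<^sub>M borel_of U) (borel_of X) T" "x \<in> X" "u \<in> U"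
  shows "T (x, u) \<in> borel_probs X"
  using assms by (intro kernel_space) (auto simp: space_pair_measure space_restrict_space)

lemma transition_averages_bound:
  assumes T: "stochastic_kernel (borel_of X \<Otimes>\<^sub>M borel_of U) (borel_of X) T"
    and F: "equicont_on X F" "\<And>f x. f \<in> F \<Longrightarrow> x \<in> X \<Longrightarrow> \<bar>f x\<bar> \<le> M"
    and g: "g \<in> transition_averages U T F" and x: "x \<in> X"
  shows "\<bar>g x\<bar> \<le> M"
proof -
  obtain u f where uf: "g = (\<lambda>x. \<integral>z. f z \<partial>T (x, u))" "u \<in> U" "f \<in> F"
    using g unfolding transition_averages_def by blast
  note Tx = transition_kernel_space[OF T x uf(2)]
  interpret prob_space "T (x, u)" by (rule borel_probsD[OF Tx])
  show ?thesis unfolding uf(1)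
    using F(2)[OF uf(3)] borel_probsD(3)[OF Tx]
      measurable_borel_probs_continuous[OF Tx equicont_on_imp_continuous_on[OF F(1) uf(3)]]
    by (intro abs_integral_le) auto
qed

text \<open>Along a subsequence of controls with limit \<open>u\<close>, both
  \<open>T (xs n, us n)\<close> and \<open>T (x, us n)\<close> converge weakly to
  \<open>T (x, u)\<close>. The integrands vary with the index as well, so weak convergence must be
  uniform over \<open>F\<close>.\<close>

lemma equicont_on_transition_averages:
  fixes X :: "'x::{metric_space, second_countable_topology} set"
    and U :: "'u::metric_space set"
  assumes T: "stochastic_kernel (borel_of X \<Otimes>\<^sub>M borel_of U) (borel_of X) T"
    and wc: "weakly_continuous_kernel (X \<times> U) X T" and U: "compact U"
    and F: "equicont_on X F" "0 \<le> M" "\<And>f x. f \<in> F \<Longrightarrow> x \<in> X \<Longrightarrow> \<bar>f x\<bar> \<le> M"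
  shows "equicont_on X (transition_averages U T F)"
proof (rule equicont_on_sequentiallyI)
  fix x and xs gs :: "nat \<Rightarrow> _"
  assume x: "x \<in> X" and xs: "\<And>n. xs n \<in> X" and gs: "\<And>n. gs n \<in> transition_averages U T F"
    and lim: "xs \<longlonglongrightarrow> x"
  obtain us fs where us: "\<And>n. us n \<in> U" "\<And>n. fs n \<in> F" "\<And>n. gs n = (\<lambda>x. \<integral>z. fs n z \<partial>T (x, us n))"
    using gs unfolding transition_averages_def mem_Collect_eq by metis
  show "(\<lambda>n. gs n (xs n) - gs n x) \<longlonglongrightarrow> 0"
  proof (rule tendsto_zero_of_subseq)
    fix r :: "nat \<Rightarrow> nat" assume r: "strict_mono r"
    obtain u s where s: "u \<in> U" "strict_mono s" "((us \<circ> r) \<circ> s) \<longlonglongrightarrow> u"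
      using seq_compactE[OF compact_imp_seq_compact[OF U], of "us \<circ> r"] us(1) by auto
    have xl: "(\<lambda>n. xs (r (s n))) \<longlonglongrightarrow> x"
      using LIMSEQ_subseq_LIMSEQ[OF LIMSEQ_subseq_LIMSEQ[OF lim r] s(2)] by (simp add: o_def)
    have ul: "(\<lambda>n. us (r (s n))) \<longlonglongrightarrow> u" using s(3) by (simp add: o_def)
    \<comment> \<open>Stated for an arbitrary sequence \<open>ys\<close> tending to \<open>x\<close>
      because it is used twice: for the subsequence of \<open>xs\<close> and for the constant
      sequence \<open>x\<close>.\<close>
    have close: "\<forall>\<^sub>F n in sequentially. \<forall>f\<in>F.
        \<bar>(\<integral>z. f z \<partial>T (ys n, us (r (s n)))) - (\<integral>z. f z \<partial>T (x, u))\<bar> < e"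
      if ys: "\<And>n. ys n \<in> X" "ys \<longlonglongrightarrow> x" and "e > 0" for ys e
    proof (rule converges_weakly_uniform[OF F(1,2)])
      show "converges_weakly X (\<lambda>n. T (ys n, us (r (s n)))) (T (x, u))"
        unfolding converges_weakly_def
      proof (intro allI impI)
        fix g :: "'x \<Rightarrow> real" assume "continuous_on X g \<and> bounded (g ` X)"
        then have "continuous_on (X \<times> U) (\<lambda>z. \<integral>x. g x \<partial>T z)"
          using wc unfolding weakly_continuous_kernel_def by blast
        from continuous_on_tendsto_compose[OF this tendsto_Pair[OF ys(2) ul]]
        show "(\<lambda>n. \<integral>x. g x \<partial>T (ys n, us (r (s n)))) \<longlonglongrightarrow> (\<integral>x. g x \<partial>T (x, u))"
          using x ys(1) us(1) s(1) by auto
      qed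
    qed (use transition_kernel_space[OF T] F(3) x ys(1) us(1) s(1) \<open>e > 0\<close> in auto)
    have "(\<lambda>n. gs (r (s n)) (xs (r (s n))) - gs (r (s n)) x) \<longlonglongrightarrow> 0"
      unfolding tendsto_iff
    proof (intro allI impI)
      fix e :: real assume "e > 0"
      then have "e / 2 > 0" by simp
      from close[OF _ xl this] xs have "\<forall>\<^sub>F n in sequentially. \<forall>f\<in>F.
        \<bar>(\<integral>z. f z \<partial>T (xs (r (s n)), us (r (s n)))) - (\<integral>z. f z \<partial>T (x, u))\<bar> < e / 2" by blast
      moreover from close[OF _ tendsto_const \<open>e / 2 > 0\<close>] x have "\<forall>\<^sub>F n in sequentially. \<forall>f\<in>F.
        \<bar>(\<integral>z. f z \<partial>T (x, us (r (s n)))) - (\<integral>z. f z \<partial>T (x, u))\<bar> < e / 2" by blast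
      ultimately show "\<forall>\<^sub>F n in sequentially.
          dist (gs (r (s n)) (xs (r (s n))) - gs (r (s n)) x) 0 < e"
      proof eventually_elim
        case (elim n)
        show ?case
          using elim[rule_format, OF us(2)[of "r (s n)"]] unfolding us(3) dist_real_def by linarith
      qed
    qed
    then show "\<exists>s. strict_mono s \<and> (\<lambda>n. gs (r (s n)) (xs (r (s n))) - gs (r (s n)) x) \<longlonglongrightarrow> 0"
      using s(2) by blast
  qed
qed

subsection \<open>Integration along the controlled process\<close>

lemma integral_bind_prob:
  fixes f :: "'b \<Rightarrow> real"
  assumes \<mu>: "\<mu> \<in> space (prob_algebra M)" and N: "N \<in> M \<rightarrow>\<^sub>M prob_algebra K"
    and f: "f \<in> borel_measurable K" "\<And>x. x \<in> space K \<Longrightarrow> \<bar>f x\<bar> \<le> B"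
  shows "(\<integral>x. f x \<partial>(\<mu> \<bind> N)) = (\<integral>x. (\<integral>y. f y \<partial>N x) \<partial>\<mu>)"
proof -
  have s: "sets \<mu> = sets M" and "prob_space \<mu>"
    using \<mu> by (auto simp: space_prob_algebra)
  interpret prob_space \<mu> by fact
  have N': "N \<in> \<mu> \<rightarrow>\<^sub>M prob_algebra K"
    using N s by (simp cong: measurable_cong_sets)
  show ?thesis
  proof (rule integral_bind[OF f measurable_prob_algebraD[OF N'], where B'=1])
    show "AE x in \<mu>. emeasure (N x) (space (N x)) \<le> ennreal 1"
    proof (rule AE_I2)
      fix x assume "x \<in> space \<mu>"
      then have "prob_space (N x)"
        using measurable_space[OF N'] by (simp add: space_prob_algebra)
      then show "emeasure (N x) (space (N x)) \<le> ennreal 1"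
        by (simp add: prob_space.emeasure_space_1)
    qed
  qed (unfold_locales)
qed

lemma integral_measurable_prob_algebra2:
  fixes f :: "'a \<Rightarrow> 'b \<Rightarrow> real"
  assumes f[measurable]: "(\<lambda>(x, y). f x y) \<in> borel_measurable (M \<Otimes>\<^sub>M N)"
    and L: "L \<in> M \<rightarrow>\<^sub>M prob_algebra N"
  shows "(\<lambda>x. \<integral>y. f x y \<partial>L x) \<in> borel_measurable M"
proof -
  note L'[measurable] = measurable_prob_algebraD[OF L]
  note integral_measurable_subprob_algebra[measurable]
  note measurable_distr2[measurable]
  \<comment> \<open>The integrand varies with \<open>x\<close> too. Pushing \<open>L x\<close>
    forward to the slice over \<open>x\<close> in the product space makes the integrand fixed and
    leaves only the measure varying.\<close>
  have "(\<lambda>x. integral\<^sup>L (distr (L x) (M \<Otimes>\<^sub>M N) (\<lambda>y. (x, y))) (\<lambda>(x, y). f x y)) \<in> borel_measurable M"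
    by measurable
  then show ?thesis
    by (rule measurable_cong[THEN iffD1, rotated])
       (simp add: integral_distr)
qed

text \<open>Continuity yields measurability for the Borel sets of the product, and second
  countability identifies these with the product sigma-algebra. This identification lives on the
  whole space, hence the extension of \<open>c\<close> by 0 outside
  \<open>X \<times> U\<close>.\<close>

lemma measurable_borel_of_Times_continuous:
  fixes c :: "'a::second_countable_topology \<times> 'b::second_countable_topology \<Rightarrow> real"
  assumes "X \<in> sets borel" "U \<in> sets borel" "continuous_on (X \<times> U) c"
  shows "c \<in> borel_measurable (borel_of X \<Otimes>\<^sub>M borel_of U)"
proof -
  have "(\<lambda>p. if p \<in> X \<times> U then c p else 0) \<in> borel_measurable borel"
    using assms by (intro borel_measurable_continuous_on_if borel_Times continuous_on_const)
  then have [measurable]: "(\<lambda>p. if p \<in> X \<times> U then c p else 0) \<in> borel_measurable (borel \<Otimes>\<^sub>M borel)"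
    by (simp add: borel_prod)
  have id: "(\<lambda>x. x) \<in> borel_of S \<rightarrow>\<^sub>M borel" for S :: "'c::topological_space set"
    by (rule measurable_restrict_space1) simp
  have "(\<lambda>p. (fst p, snd p)) \<in> borel_of X \<Otimes>\<^sub>M borel_of U \<rightarrow>\<^sub>M borel \<Otimes>\<^sub>M borel"
    by (intro measurable_Pair measurable_compose[OF measurable_fst id] measurable_compose[OF measurable_snd id])
  then have "(\<lambda>p. p) \<in> borel_of X \<Otimes>\<^sub>M borel_of U \<rightarrow>\<^sub>M borel \<Otimes>\<^sub>M borel"
    by simp
  from measurable_compose[OF this, of "\<lambda>p. if p \<in> X \<times> U then c p else 0" borel]
  have "(\<lambda>p. if p \<in> X \<times> U then c p else 0) \<in> borel_measurable (borel_of X \<Otimes>\<^sub>M borel_of U)"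
    by simp
  then show ?thesis
    by (rule measurable_cong[THEN iffD1, rotated]) (auto simp: space_pair_measure space_restrict_space)
qed

section \<open>The process up to a stage, and the law of its next stage\<close>

locale controlled_process =
  fixes X :: "'x::euclidean_space set" and Y :: "'y::euclidean_space set"
    and U :: "'u::euclidean_space set"
    and Q :: "'x \<Rightarrow> 'y measure" and T :: "'x \<times> 'u \<Rightarrow> 'x measure"
  assumes Q: "stochastic_kernel (borel_of X) (borel_of Y) Q"
    and T: "stochastic_kernel (borel_of X \<Otimes>\<^sub>M borel_of U) (borel_of X) T"
begin

abbreviation "stage \<equiv> stage_space X Y U"
abbreviation past :: "nat \<Rightarrow> (nat \<Rightarrow> 'x \<times> 'y \<times> 'u) measure" where
  "past t \<equiv> PiM {0..<t} (\<lambda>_. stage)"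

definition control :: "('y, 'u) policy \<Rightarrow> nat \<Rightarrow> (nat \<Rightarrow> 'x \<times> 'y \<times> 'u) \<Rightarrow> 'y \<Rightarrow> 'u" where
  "control \<gamma> t \<omega> y = \<gamma> t (information t \<omega> y)"

definition state_law :: "'x measure \<Rightarrow> nat \<Rightarrow> (nat \<Rightarrow> 'x \<times> 'y \<times> 'u) \<Rightarrow> 'x measure" where
  "state_law P t \<omega> = (case t of 0 \<Rightarrow> P | Suc s \<Rightarrow> T (state_at \<omega> s, control_at \<omega> s))"

text \<open>The path \<open>\<lambda>_. undefined\<close> is the only element of
  \<open>past 0\<close>, so the construction starts from an empty history.\<close>

definition past_law :: "'x measure \<Rightarrow> ('y, 'u) policy \<Rightarrow> nat \<Rightarrow> (nat \<Rightarrow> 'x \<times> 'y \<times> 'u) measure" where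
  "past_law P \<gamma> t = Ionescu_Tulcea.C (stage_kernel X Y U Q P T \<gamma>) (\<lambda>_. stage) 0 t (\<lambda>_. undefined)"

text \<open>\<open>expect\<close> stops between stages: the state \<open>X\<^sub>t\<close> has been reached, but the observation
  \<open>Y\<^sub>t\<close> has not been made yet.\<close>

definition expect :: "'x measure \<Rightarrow> ('y, 'u) policy \<Rightarrow> nat
    \<Rightarrow> ((nat \<Rightarrow> 'x \<times> 'y \<times> 'u) \<Rightarrow> 'x \<Rightarrow> real) \<Rightarrow> real" where
  "expect P \<gamma> t \<phi> = (\<integral>\<omega>. (\<integral>x. \<phi> \<omega> x \<partial>state_law P t \<omega>) \<partial>past_law P \<gamma> t)"

lemma space_stage: "space stage = X \<times> Y \<times> U"
  by (simp add: stage_space_def space_pair_measure space_restrict_space)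

lemma measurable_control:
  assumes "\<gamma> \<in> admissible_policies Y U"
  shows "(\<lambda>(\<omega>, y). control \<gamma> t \<omega> y) \<in> (past t \<Otimes>\<^sub>M borel_of Y) \<rightarrow>\<^sub>M borel_of U"
  using measurable_compose[OF measurable_information[OF refl, where X=X and Y=Y and U=U and t=t],
      of "\<gamma> t" "borel_of U"] assms
  by (simp add: admissible_policies_def control_def split_beta')

lemma control_in:
  assumes "\<gamma> \<in> admissible_policies Y U" "\<omega> \<in> space (past t)" "y \<in> Y"
  shows "control \<gamma> t \<omega> y \<in> U"
  using measurable_space[OF measurable_control[OF assms(1)], of "(\<omega>, y)" t] assms(2,3)
  by (simp add: space_pair_measure space_restrict_space)

text \<open>Partial observation in usable form: the second component of a stage holds the
  observation and the control, and states never reach the policy.\<close>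

lemma control_cong:
  assumes "\<And>i. i < t \<Longrightarrow> snd (\<omega> i) = snd (\<omega>' i)"
  shows "control \<gamma> t \<omega> y = control \<gamma> t \<omega>' y"
proof -
  have "information t \<omega> y = information t \<omega>' y"
    using assms by (auto simp: information_def observation_at_def control_at_def restrict_def)
  then show ?thesis by (simp add: control_def)
qed

lemma measurable_coordinate:
  assumes "i < t"
  shows "(\<lambda>\<omega>. (state_at \<omega> i, control_at \<omega> i)) \<in> past t \<rightarrow>\<^sub>M borel_of X \<Otimes>\<^sub>M borel_of U"
proof -
  have xu: "(\<lambda>s. (fst s, snd (snd s))) \<in> stage \<rightarrow>\<^sub>M (borel_of X \<Otimes>\<^sub>M borel_of U)"
    unfolding stage_space_def by measurable
  have "(\<lambda>\<omega>. \<omega> i) \<in> past t \<rightarrow>\<^sub>M stage"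
    using assms by (intro measurable_component_singleton) simp
  from measurable_compose[OF this xu] show ?thesis
    by (simp add: state_at_def control_at_def)
qed

lemma measurable_state_law:
  assumes "P \<in> borel_probs X"
  shows "state_law P t \<in> past t \<rightarrow>\<^sub>M prob_algebra (borel_of X)"
proof (cases t)
  case 0
  then show ?thesis using assms by (simp add: state_law_def[abs_def])
next
  case (Suc s)
  from measurable_compose[OF measurable_coordinate[of s t] T] Suc show ?thesis
    by (simp add: state_law_def[abs_def])
qed

lemma state_law_in:
  assumes "P \<in> borel_probs X" "\<omega> \<in> space (past t)"
  shows "state_law P t \<omega> \<in> borel_probs X"
  using measurable_space[OF measurable_state_law[OF assms(1)] assms(2)] .

lemma observation_law_in: "x \<in> X \<Longrightarrow> Q x \<in> borel_probs Y"
  using measurable_space[OF Q] by (simp add: space_restrict_space)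

lemma past_law_prob:
  assumes "P \<in> borel_probs X" "\<gamma> \<in> admissible_policies Y U"
  shows "past_law P \<gamma> t \<in> space (prob_algebra (past t))"
proof -
  interpret Ionescu_Tulcea "stage_kernel X Y U Q P T \<gamma>" "\<lambda>_. stage"
    by (rule Ionescu_Tulcea_stage_kernel[OF Q T assms])
  show ?thesis
    using prob_space_C[of "\<lambda>_. undefined" 0 t] sets_C[of "\<lambda>_. undefined" 0 t]
    by (simp add: past_law_def space_prob_algebra)
qed

lemma past_lawD:
  assumes "P \<in> borel_probs X" "\<gamma> \<in> admissible_policies Y U"
  shows "prob_space (past_law P \<gamma> t)" "sets (past_law P \<gamma> t) = sets (past t)"
    "space (past_law P \<gamma> t) = space (past t)"
  using past_law_prob[OF assms] by (auto simp: space_prob_algebra dest: sets_eq_imp_space_eq)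

lemma fun_upd_in_past:
  assumes "\<omega> \<in> space (past t)" "x \<in> X" "y \<in> Y" "u \<in> U"
  shows "fun_upd \<omega> t (x, y, u) \<in> space (past (Suc t))"
  using assms by (auto simp: space_PiM space_stage PiE_iff extensional_def)

lemma expect_cong:
  assumes "P \<in> borel_probs X" "\<gamma> \<in> admissible_policies Y U"
    and "\<And>\<omega> x. \<omega> \<in> space (past t) \<Longrightarrow> x \<in> X \<Longrightarrow> \<phi> \<omega> x = \<psi> \<omega> x"
  shows "expect P \<gamma> t \<phi> = expect P \<gamma> t \<psi>"
  unfolding expect_def
  using assms(3) past_lawD(3)[OF assms(1,2)] borel_probsD(3)[OF state_law_in[OF assms(1)]]
  by (intro Bochner_Integration.integral_cong refl) auto

lemma measurable_fun_upd_control: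
  assumes \<gamma>: "\<gamma> \<in> admissible_policies Y U" and x: "x \<in> M \<rightarrow>\<^sub>M borel_of X"
    and \<omega>: "\<omega> \<in> M \<rightarrow>\<^sub>M past t" and y: "y \<in> M \<rightarrow>\<^sub>M borel_of Y"
  shows "(\<lambda>p. fun_upd (\<omega> p) t (x p, y p, control \<gamma> t (\<omega> p) (y p))) \<in> M \<rightarrow>\<^sub>M past (Suc t)"
proof (rule measurable_fun_upd[where J="{0..<t}"])
  have "(\<lambda>p. control \<gamma> t (\<omega> p) (y p)) \<in> M \<rightarrow>\<^sub>M borel_of U"
    using measurable_compose[OF measurable_Pair[OF \<omega> y] measurable_control[OF \<gamma>]] by simp
  then show "(\<lambda>p. (x p, y p, control \<gamma> t (\<omega> p) (y p))) \<in> M \<rightarrow>\<^sub>M stage"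
    unfolding stage_space_def using x y by (intro measurable_Pair)
qed (use \<omega> in auto)

text \<open>The law up to \<open>Suc t\<close> appends a draw from the stage kernel to a past up to
  \<open>t\<close>. That kernel is a nested bind over state and observation followed by a point mass
  at the control, so the integral unfolds in this order, with the state law outside as in
  \<open>expect\<close>.\<close>

lemma integral_past_law_Suc:
  assumes P: "P \<in> borel_probs X" and \<gamma>: "\<gamma> \<in> admissible_policies Y U"
    and g: "g \<in> borel_measurable (past (Suc t))" "\<And>\<omega>. \<omega> \<in> space (past (Suc t)) \<Longrightarrow> \<bar>g \<omega>\<bar> \<le> B"
  shows "(\<integral>\<omega>. g \<omega> \<partial>past_law P \<gamma> (Suc t)) =
    expect P \<gamma> t (\<lambda>\<omega> x. \<integral>y. g (fun_upd \<omega> t (x, y, control \<gamma> t \<omega> y)) \<partial>Q x)"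
proof -
  interpret IT: Ionescu_Tulcea "stage_kernel X Y U Q P T \<gamma>" "\<lambda>_. stage"
    by (rule Ionescu_Tulcea_stage_kernel[OF Q T assms(1,2)])
  have eP: "IT.eP t \<in> past t \<rightarrow>\<^sub>M prob_algebra (past (Suc t))"
    by (rule measurable_prob_algebraI) (auto intro: IT.prob_space_eP)
  have C: "past_law P \<gamma> (Suc t) = past_law P \<gamma> t \<bind> IT.eP t"
    by (simp add: past_law_def)
  have "(\<integral>s. g s \<partial>IT.eP t \<omega>) = (\<integral>x. \<integral>y. g (fun_upd \<omega> t (x, y, control \<gamma> t \<omega> y)) \<partial>Q x \<partial>state_law P t \<omega>)"
    if \<omega>: "\<omega> \<in> space (past t)" for \<omega>
  proof -
    have upd: "fun_upd \<omega> t \<in> stage \<rightarrow>\<^sub>M past (Suc t)"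
      using \<omega> by (intro measurable_fun_upd[where J="{0..<t}"]) auto
    define h where "h s = g (fun_upd \<omega> t s)" for s
    have h: "h \<in> borel_measurable stage" "\<And>s. s \<in> space stage \<Longrightarrow> \<bar>h s\<bar> \<le> B"
      using measurable_compose[OF upd g(1)] g(2) measurable_space[OF upd] by (auto simp: h_def[abs_def])
    have hs: "s \<in> space stage" if "s \<in> X \<times> Y \<times> U" for s using that by (simp add: space_stage)
    have cu: "(\<lambda>y. control \<gamma> t \<omega> y) \<in> borel_of Y \<rightarrow>\<^sub>M borel_of U"
      using measurable_compose[OF measurable_Pair1'[OF \<omega>] measurable_control[OF \<gamma>]] by simp
    have r: "(\<lambda>(x, y). return stage (x, y, control \<gamma> t \<omega> y))
        \<in> borel_of X \<Otimes>\<^sub>M borel_of Y \<rightarrow>\<^sub>M prob_algebra stage"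
    proof -
      have "(\<lambda>p. (fst p, snd p, control \<gamma> t \<omega> (snd p))) \<in> borel_of X \<Otimes>\<^sub>M borel_of Y \<rightarrow>\<^sub>M stage"
        unfolding stage_space_def using measurable_compose[OF measurable_snd cu]
        by (intro measurable_Pair measurable_fst measurable_snd)
      from measurable_compose[OF this measurable_return_prob_space] show ?thesis
        by (simp add: split_beta')
    qed
    have r': "(\<lambda>y. return stage (x, y, control \<gamma> t \<omega> y)) \<in> borel_of Y \<rightarrow>\<^sub>M prob_algebra stage"
      if "x \<in> X" for x
      using measurable_compose[OF measurable_Pair1' r, of x] that by (simp add: space_restrict_space)
    have "(\<integral>s. g s \<partial>IT.eP t \<omega>) = (\<integral>s. h s \<partial>stage_kernel X Y U Q P T \<gamma> t \<omega>)"
      unfolding IT.eP_def h_def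
    proof (rule integral_distr)
      show "fun_upd \<omega> t \<in> stage_kernel X Y U Q P T \<gamma> t \<omega> \<rightarrow>\<^sub>M past (Suc t)"
        using upd IT.sets_P[OF \<omega>] by (simp cong: measurable_cong_sets)
    qed (rule g(1))
    also have "\<dots> = (\<integral>s. h s \<partial>(state_law P t \<omega> \<bind>
        (\<lambda>x. Q x \<bind> (\<lambda>y. return stage (x, y, control \<gamma> t \<omega> y)))))"
      by (simp add: stage_kernel_def state_law_def control_def)
    also have "\<dots> = (\<integral>x. (\<integral>s. h s \<partial>(Q x \<bind> (\<lambda>y. return stage (x, y, control \<gamma> t \<omega> y))))
        \<partial>state_law P t \<omega>)"
      by (rule integral_bind_prob[OF state_law_in[OF P \<omega>] measurable_bind_prob_space2[OF Q r] h])
    also have "\<dots> = (\<integral>x. (\<integral>y. h (x, y, control \<gamma> t \<omega> y) \<partial>Q x) \<partial>state_law P t \<omega>)"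
    proof (rule Bochner_Integration.integral_cong[OF refl])
      fix x assume "x \<in> space (state_law P t \<omega>)"
      then have x: "x \<in> X" using borel_probsD(3)[OF state_law_in[OF P \<omega>]] by simp
      have "(\<integral>s. h s \<partial>(Q x \<bind> (\<lambda>y. return stage (x, y, control \<gamma> t \<omega> y)))) =
        (\<integral>y. (\<integral>s. h s \<partial>return stage (x, y, control \<gamma> t \<omega> y)) \<partial>Q x)"
        by (rule integral_bind_prob[OF observation_law_in[OF x] r'[OF x] h])
      also have "\<dots> = (\<integral>y. h (x, y, control \<gamma> t \<omega> y) \<partial>Q x)"
        using x h(1) control_in[OF \<gamma> \<omega>] borel_probsD(3)[OF observation_law_in[OF x]]
        by (intro Bochner_Integration.integral_cong refl integral_return) (auto simp: space_stage)
      finally show "(\<integral>s. h s \<partial>(Q x \<bind> (\<lambda>y. return stage (x, y, control \<gamma> t \<omega> y)))) =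
        (\<integral>y. h (x, y, control \<gamma> t \<omega> y) \<partial>Q x)" .
    qed
    finally show ?thesis by (simp add: h_def)
  qed
  then have "(\<integral>\<omega>. (\<integral>s. g s \<partial>IT.eP t \<omega>) \<partial>past_law P \<gamma> t) =
      expect P \<gamma> t (\<lambda>\<omega> x. \<integral>y. g (fun_upd \<omega> t (x, y, control \<gamma> t \<omega> y)) \<partial>Q x)"
    unfolding expect_def
    using past_lawD(3)[OF P \<gamma>] by (intro Bochner_Integration.integral_cong) auto
  with integral_bind_prob[OF past_law_prob[OF P \<gamma>] eP g] show ?thesis
    by (simp add: C)
qed

lemma integral_path_measure:
  assumes P: "P \<in> borel_probs X" and \<gamma>: "\<gamma> \<in> admissible_policies Y U"
    and g: "g \<in> borel_measurable (past n)"
  shows "(\<integral>\<omega>. g (restrict \<omega> {0..<n}) \<partial>path_measure X Y U Q P T \<gamma>) =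
    (\<integral>\<omega>. (g \<omega> :: real) \<partial>past_law P \<gamma> n)"
proof -
  interpret IT: Ionescu_Tulcea "stage_kernel X Y U Q P T \<gamma>" "\<lambda>_. stage"
    by (rule Ionescu_Tulcea_stage_kernel[OF Q T assms(1,2)])
  \<comment> \<open>The set \<open>{0..<n}\<close> is already an initial segment, so the projection
    that defines \<open>CI\<close> on it forgets no coordinate.\<close>
  have up: "IT.up_to {0..<n} = n"
    using IT.up_to[of "{0..<n}"] by (intro antisym) (auto simp: IT.up_to_iff_Ico)
  have "distr IT.PF.lim (past n) (\<lambda>\<omega>. restrict \<omega> {0..<n}) = past_law P \<gamma> n"
    using IT.distr_lim[of "{0..<n}"] IT.distr_C[of n n "\<lambda>_. undefined" 0]
    by (simp add: IT.CI_def up past_law_def)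
  moreover have "(\<lambda>\<omega>. restrict \<omega> {0..<n}) \<in> IT.PF.lim \<rightarrow>\<^sub>M past n"
    by (simp add: measurable_cong_sets[OF IT.PF.sets_lim refl] measurable_restrict_subset)
  ultimately show ?thesis
    unfolding path_measure_def using integral_distr[OF _ g, of "\<lambda>\<omega>. restrict \<omega> {0..<n}" IT.PF.lim]
    by simp
qed

lemma path_measure_prob:
  assumes P: "P \<in> borel_probs X" and \<gamma>: "\<gamma> \<in> admissible_policies Y U"
  shows "prob_space (path_measure X Y U Q P T \<gamma>)"
    "sets (path_measure X Y U Q P T \<gamma>) = sets (PiM UNIV (\<lambda>_. stage))"
proof -
  interpret IT: Ionescu_Tulcea "stage_kernel X Y U Q P T \<gamma>" "\<lambda>_. stage"
    by (rule Ionescu_Tulcea_stage_kernel[OF Q T assms(1,2)])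
  show "sets (path_measure X Y U Q P T \<gamma>) = sets (PiM UNIV (\<lambda>_. stage))"
    by (simp add: path_measure_def)
  show "prob_space (path_measure X Y U Q P T \<gamma>)"
    unfolding path_measure_def
  proof (rule prob_spaceI)
    \<comment> \<open>The total mass is read off from the empty index set: its cylinder is the whole
      path space and its marginal is a probability on a single point.\<close>
    have "space (IT.CI {}) = {\<lambda>_. undefined}"
      by (simp add: IT.CI_def space_PiM)
    then have "emeasure (IT.CI {}) {\<lambda>_. undefined} = 1"
      using prob_space.emeasure_space_1[OF IT.PF.prob_space_P[of "{}"]] by simp
    then show "emeasure IT.PF.lim (space IT.PF.lim) = 1"
      using IT.lim[of "{}" "{\<lambda>_. undefined}"]
      by (simp add: sets_PiM_empty prod_emb_def space_PiM restrict_def vimage_def)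
  qed
qed

subsection \<open>Uniform convergence over policies\<close>

text \<open>The third condition, independence of past states, is what allows the past state to be replaced
  by a fixed \<open>x0\<close> in \<open>expect_Suc\<close>; otherwise \<open>\<phi>\<close> could depend discontinuously on it.\<close>

definition test_functions :: "nat \<Rightarrow> ('x \<Rightarrow> real) set \<Rightarrow> ((nat \<Rightarrow> 'x \<times> 'y \<times> 'u) \<Rightarrow> 'x \<Rightarrow> real) set" where
  "test_functions t F = {\<phi>. (\<lambda>(\<omega>, x). \<phi> \<omega> x) \<in> borel_measurable (past t \<Otimes>\<^sub>M borel_of X) \<and>
     (\<forall>\<omega>\<in>space (past t). \<phi> \<omega> \<in> F) \<and>
     (\<forall>\<omega>\<in>space (past t). \<forall>\<omega>'\<in>space (past t). (\<forall>i<t. snd (\<omega> i) = snd (\<omega>' i)) \<longrightarrow>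
        (\<forall>x\<in>X. \<phi> \<omega> x = \<phi> \<omega>' x))}"

lemma test_functionsD:
  assumes "\<phi> \<in> test_functions t F"
  shows "(\<lambda>(\<omega>, x). \<phi> \<omega> x) \<in> borel_measurable (past t \<Otimes>\<^sub>M borel_of X)"
    and "\<omega> \<in> space (past t) \<Longrightarrow> \<phi> \<omega> \<in> F"
    and "\<omega> \<in> space (past t) \<Longrightarrow> \<omega>' \<in> space (past t) \<Longrightarrow> (\<And>i. i < t \<Longrightarrow> snd (\<omega> i) = snd (\<omega>' i))
      \<Longrightarrow> x \<in> X \<Longrightarrow> \<phi> \<omega> x = \<phi> \<omega>' x"
  using assms unfolding test_functions_def by blast+

text \<open>Serves both the stage cost and the backward step. Independence of past states survives
  the integration because the observation law depends on the current state only.\<close>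

lemma test_functions_mixtures:
  assumes m: "(\<lambda>((\<omega>, x), y). k \<omega> x y) \<in> borel_measurable ((past t \<Otimes>\<^sub>M borel_of X) \<Otimes>\<^sub>M borel_of Y)"
    and G: "\<And>\<omega> y. \<omega> \<in> space (past t) \<Longrightarrow> y \<in> Y \<Longrightarrow> (\<lambda>x. k \<omega> x y) \<in> G"
    and inv: "\<And>\<omega> \<omega>' x y. \<omega> \<in> space (past t) \<Longrightarrow> \<omega>' \<in> space (past t) \<Longrightarrow>
      (\<And>i. i < t \<Longrightarrow> snd (\<omega> i) = snd (\<omega>' i)) \<Longrightarrow> x \<in> X \<Longrightarrow> y \<in> Y \<Longrightarrow> k \<omega> x y = k \<omega>' x y"
  shows "(\<lambda>\<omega> x. \<integral>y. k \<omega> x y \<partial>Q x) \<in> test_functions t (mixtures X Y Q G)"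
  unfolding test_functions_def mem_Collect_eq
proof (intro conjI ballI impI)
  have "(\<lambda>p. \<integral>y. k (fst p) (snd p) y \<partial>Q (snd p)) \<in> borel_measurable (past t \<Otimes>\<^sub>M borel_of X)"
    using m by (intro integral_measurable_prob_algebra2[OF _ measurable_compose[OF measurable_snd Q]])
       (simp add: split_beta')
  then show "(\<lambda>(\<omega>, x). \<integral>y. k \<omega> x y \<partial>Q x) \<in> borel_measurable (past t \<Otimes>\<^sub>M borel_of X)"
    by (simp add: split_beta')
next
  fix \<omega> assume \<omega>: "\<omega> \<in> space (past t)"
  have "k \<omega> x \<in> borel_measurable (borel_of Y)" if "x \<in> X" for x
    using measurable_compose[OF measurable_Pair1'[of "(\<omega>, x)"] m] that \<omega>
    by (simp add: space_pair_measure space_restrict_space)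
  then show "(\<lambda>x. \<integral>y. k \<omega> x y \<partial>Q x) \<in> mixtures X Y Q G"
    using G[OF \<omega>] unfolding mixtures_def by blast
next
  fix \<omega> \<omega>' x assume "\<omega> \<in> space (past t)" "\<omega>' \<in> space (past t)"
    "\<forall>i<t. snd (\<omega> i) = snd (\<omega>' i)" and x: "x \<in> X"
  then show "(\<integral>y. k \<omega> x y \<partial>Q x) = (\<integral>y. k \<omega>' x y \<partial>Q x)"
    using borel_probsD(3)[OF observation_law_in[OF x]]
    by (intro Bochner_Integration.integral_cong refl inv) auto
qed

lemma test_functions_step:
  assumes \<gamma>: "\<gamma> \<in> admissible_policies Y U" and \<phi>: "\<phi> \<in> test_functions (Suc t) F" and x0: "x0 \<in> X"
  shows "(\<lambda>\<omega> x. \<integral>y. (\<integral>z. \<phi> (fun_upd \<omega> t (x0, y, control \<gamma> t \<omega> y)) z \<partial>T (x, control \<gamma> t \<omega> y)) \<partial>Q x)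
    \<in> test_functions t (mixtures X Y Q (transition_averages U T F))"
proof (rule test_functions_mixtures)
  let ?M = "(past t \<Otimes>\<^sub>M borel_of X) \<Otimes>\<^sub>M borel_of Y"
  have [measurable]: "(\<lambda>p. fst (fst p)) \<in> ?M \<rightarrow>\<^sub>M past t" "(\<lambda>p. snd (fst p)) \<in> ?M \<rightarrow>\<^sub>M borel_of X"
    "snd \<in> ?M \<rightarrow>\<^sub>M borel_of Y"
    by measurable
  have cu: "(\<lambda>p. control \<gamma> t (fst (fst p)) (snd p)) \<in> ?M \<rightarrow>\<^sub>M borel_of U"
    using measurable_compose[OF _ measurable_control[OF \<gamma>], of "\<lambda>p. (fst (fst p), snd p)" ?M t]
    by simp
  have "(\<lambda>p. (snd (fst p), control \<gamma> t (fst (fst p)) (snd p))) \<in> ?M \<rightarrow>\<^sub>M borel_of X \<Otimes>\<^sub>M borel_of U"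
    using cu by (intro measurable_Pair) measurable
  note TM = measurable_compose[OF this T]
  have "(\<lambda>p. fun_upd (fst (fst p)) t (x0, snd p, control \<gamma> t (fst (fst p)) (snd p))) \<in> ?M \<rightarrow>\<^sub>M past (Suc t)"
    using x0 by (intro measurable_fun_upd_control[OF \<gamma>]) (auto simp: space_restrict_space)
  then have "(\<lambda>q. (fun_upd (fst (fst (fst q))) t (x0, snd (fst q), control \<gamma> t (fst (fst (fst q))) (snd (fst q))), snd q))
      \<in> ?M \<Otimes>\<^sub>M borel_of X \<rightarrow>\<^sub>M past (Suc t) \<Otimes>\<^sub>M borel_of X"
    by (intro measurable_Pair measurable_snd) (rule measurable_compose[OF measurable_fst])
  from measurable_compose[OF this test_functionsD(1)[OF \<phi>]]
  have "(\<lambda>p. \<integral>z. \<phi> (fun_upd (fst (fst p)) t (x0, snd p, control \<gamma> t (fst (fst p)) (snd p))) z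
      \<partial>T (snd (fst p), control \<gamma> t (fst (fst p)) (snd p))) \<in> borel_measurable ?M"
    by (intro integral_measurable_prob_algebra2[OF _ TM]) (simp add: split_beta')
  then show "(\<lambda>((\<omega>, x), y). \<integral>z. \<phi> (fun_upd \<omega> t (x0, y, control \<gamma> t \<omega> y)) z \<partial>T (x, control \<gamma> t \<omega> y))
      \<in> borel_measurable ?M"
    by (simp add: split_beta')
next
  \<comment> \<open>With the placeholder \<open>x0\<close> in the history, the continuation is one
    member of \<open>F\<close> for all \<open>x\<close>. Recording \<open>x\<close> itself would let
    the member vary with \<open>x\<close>, and the result would be no transition average.\<close>
  fix \<omega> y assume "\<omega> \<in> space (past t)" "y \<in> Y"
  then show "(\<lambda>x. \<integral>z. \<phi> (fun_upd \<omega> t (x0, y, control \<gamma> t \<omega> y)) z \<partial>T (x, control \<gamma> t \<omega> y))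
      \<in> transition_averages U T F"
    using test_functionsD(2)[OF \<phi> fun_upd_in_past[OF _ x0]] control_in[OF \<gamma>]
    unfolding transition_averages_def by blast
next
  fix \<omega> \<omega>' x y assume \<omega>: "\<omega> \<in> space (past t)" "\<omega>' \<in> space (past t)"
    and eq: "\<And>i. i < t \<Longrightarrow> snd (\<omega> i) = snd (\<omega>' i)" and x: "x \<in> X" "y \<in> Y"
  have c: "control \<gamma> t \<omega>' y = control \<gamma> t \<omega> y"
    using control_cong[of t \<omega> \<omega>'] eq by simp
  have u: "control \<gamma> t \<omega> y \<in> U" by (rule control_in[OF \<gamma> \<omega>(1) x(2)])
  show "(\<integral>z. \<phi> (fun_upd \<omega> t (x0, y, control \<gamma> t \<omega> y)) z \<partial>T (x, control \<gamma> t \<omega> y)) =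
    (\<integral>z. \<phi> (fun_upd \<omega>' t (x0, y, control \<gamma> t \<omega>' y)) z \<partial>T (x, control \<gamma> t \<omega>' y))"
    unfolding c
  proof (rule Bochner_Integration.integral_cong[OF refl])
    fix z assume "z \<in> space (T (x, control \<gamma> t \<omega> y))"
    then have "z \<in> X" using borel_probsD(3)[OF transition_kernel_space[OF T x(1) u]] by simp
    then show "\<phi> (fun_upd \<omega> t (x0, y, control \<gamma> t \<omega> y)) z = \<phi> (fun_upd \<omega>' t (x0, y, control \<gamma> t \<omega> y)) z"
      using fun_upd_in_past[OF \<omega>(1) x0 x(2) u] fun_upd_in_past[OF \<omega>(2) x0 x(2) u] eq
      by (intro test_functionsD(3)[OF \<phi>]) (auto simp: less_Suc_eq)
  qed
qed

text \<open>After time 0 the state law is given by \<open>T\<close> and no longer mentions the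
  prior. The function on the right is therefore the same for every \<open>P\<close>, which lets two
  priors be compared by induction on the stage.\<close>

lemma expect_Suc:
  assumes P: "P \<in> borel_probs X" and \<gamma>: "\<gamma> \<in> admissible_policies Y U"
    and \<phi>: "\<phi> \<in> test_functions (Suc t) F" and x0: "x0 \<in> X"
    and F: "\<And>f x. f \<in> F \<Longrightarrow> x \<in> X \<Longrightarrow> \<bar>f x\<bar> \<le> M"
  shows "expect P \<gamma> (Suc t) \<phi> = expect P \<gamma> t (\<lambda>\<omega> x. \<integral>y. (\<integral>z.
    \<phi> (fun_upd \<omega> t (x0, y, control \<gamma> t \<omega> y)) z \<partial>T (x, control \<gamma> t \<omega> y)) \<partial>Q x)"
proof -
  let ?g = "\<lambda>\<omega>. \<integral>z. \<phi> \<omega> z \<partial>state_law P (Suc t) \<omega>"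
  have gm: "?g \<in> borel_measurable (past (Suc t))"
    using test_functionsD(1)[OF \<phi>] by (intro integral_measurable_prob_algebra2[OF _ measurable_state_law[OF P]])
  have gb: "\<bar>?g \<omega>\<bar> \<le> M" if \<omega>: "\<omega> \<in> space (past (Suc t))" for \<omega>
  proof -
    note S = state_law_in[OF P \<omega>]
    interpret prob_space "state_law P (Suc t) \<omega>" by (rule borel_probsD[OF S])
    have "\<phi> \<omega> \<in> borel_measurable (borel_of X)"
      using measurable_compose[OF measurable_Pair1'[OF \<omega>] test_functionsD(1)[OF \<phi>]] by simp
    then show ?thesis
      using F[OF test_functionsD(2)[OF \<phi> \<omega>]] borel_probsD(2,3)[OF S]
      by (intro abs_integral_le) (auto cong: measurable_cong_sets)
  qed
  have "expect P \<gamma> (Suc t) \<phi> = (\<integral>\<omega>. ?g \<omega> \<partial>past_law P \<gamma> (Suc t))"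
    by (simp add: expect_def)
  also have "\<dots> = expect P \<gamma> t (\<lambda>\<omega> x. \<integral>y. ?g (fun_upd \<omega> t (x, y, control \<gamma> t \<omega> y)) \<partial>Q x)"
    by (rule integral_past_law_Suc[OF P \<gamma> gm gb])
  also have "\<dots> = expect P \<gamma> t (\<lambda>\<omega> x. \<integral>y. (\<integral>z.
    \<phi> (fun_upd \<omega> t (x0, y, control \<gamma> t \<omega> y)) z \<partial>T (x, control \<gamma> t \<omega> y)) \<partial>Q x)"
  proof (rule expect_cong[OF P \<gamma>], rule Bochner_Integration.integral_cong[OF refl])
    fix \<omega> x y assume \<omega>: "\<omega> \<in> space (past t)" and x: "x \<in> X" and "y \<in> space (Q x)"
    then have y: "y \<in> Y" using borel_probsD(3)[OF observation_law_in[OF x]] by simp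
    note u = control_in[OF \<gamma> \<omega> y]
    have "?g (fun_upd \<omega> t (x, y, control \<gamma> t \<omega> y)) =
        (\<integral>z. \<phi> (fun_upd \<omega> t (x, y, control \<gamma> t \<omega> y)) z \<partial>T (x, control \<gamma> t \<omega> y))"
      by (simp add: state_law_def state_at_def control_at_def)
    also have "\<dots> = (\<integral>z. \<phi> (fun_upd \<omega> t (x0, y, control \<gamma> t \<omega> y)) z \<partial>T (x, control \<gamma> t \<omega> y))"
      using borel_probsD(3)[OF transition_kernel_space[OF T x u]]
        fun_upd_in_past[OF \<omega> x y u] fun_upd_in_past[OF \<omega> x0 y u]
      by (intro Bochner_Integration.integral_cong refl test_functionsD(3)[OF \<phi>]) auto
    finally show "?g (fun_upd \<omega> t (x, y, control \<gamma> t \<omega> y)) =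
      (\<integral>z. \<phi> (fun_upd \<omega> t (x0, y, control \<gamma> t \<omega> y)) z \<partial>T (x, control \<gamma> t \<omega> y))" .
  qed
  finally show ?thesis .
qed

lemma expect_0:
  assumes P: "P \<in> borel_probs X" and \<gamma>: "\<gamma> \<in> admissible_policies Y U"
    and \<phi>: "\<phi> \<in> test_functions 0 F"
  shows "expect P \<gamma> 0 \<phi> = (\<integral>x. \<phi> (\<lambda>_. undefined) x \<partial>P)"
proof -
  interpret IT: Ionescu_Tulcea "stage_kernel X Y U Q P T \<gamma>" "\<lambda>_. stage"
    by (rule Ionescu_Tulcea_stage_kernel[OF Q T P \<gamma>])
  have "(\<lambda>\<omega>. \<integral>x. \<phi> \<omega> x \<partial>state_law P 0 \<omega>) \<in> borel_measurable (past 0)"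
    using test_functionsD(1)[OF \<phi>] by (intro integral_measurable_prob_algebra2[OF _ measurable_state_law[OF P]])
  then show ?thesis
    unfolding expect_def past_law_def by (simp add: integral_return space_PiM state_law_def)
qed

context
  assumes weak: "weakly_continuous_kernel (X \<times> U) X T"
    and tv: "tv_continuous_kernel X Q"
    and compact: "compact U"
begin

lemma expect_uniform_convergence:
  assumes P: "P \<in> borel_probs X" and Ps: "\<And>n. Ps n \<in> borel_probs X"
    and conv: "converges_weakly X Ps P"
    and "equicont_on X F" "0 \<le> M" "\<And>f x. f \<in> F \<Longrightarrow> x \<in> X \<Longrightarrow> \<bar>f x\<bar> \<le> M" and e: "e > 0"
  shows "\<forall>\<^sub>F n in sequentially. \<forall>\<gamma>\<in>admissible_policies Y U. \<forall>\<phi>\<in>test_functions t F.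
    \<bar>expect (Ps n) \<gamma> t \<phi> - expect P \<gamma> t \<phi>\<bar> < e"
  using assms(4-6)
\<comment> \<open>The step replaces \<open>F\<close> by the mixtures of its transition averages,
  hence the generalisation over \<open>F\<close>. The bound \<open>M\<close> and the tolerance
  \<open>e\<close> stay the same throughout.\<close>
proof (induction t arbitrary: F)
  case 0
  have "(\<lambda>_. undefined) \<in> space (past 0)" by (simp add: space_PiM)
  then have "\<phi> (\<lambda>_. undefined) \<in> F" if "\<phi> \<in> test_functions 0 F" for \<phi>
    using test_functionsD(2)[OF that] by blast
  moreover have "\<forall>\<^sub>F n in sequentially. \<forall>f\<in>F. \<bar>(\<integral>x. f x \<partial>Ps n) - (\<integral>x. f x \<partial>P)\<bar> < e"
    by (rule converges_weakly_uniform[where M=M, OF 0(1,2) _ _ P conv e]) (use 0(3) Ps in auto)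
  ultimately show ?case
    by (auto elim!: eventually_mono simp: expect_0[OF P] expect_0[OF Ps])
next
  case (Suc t)
  let ?G = "transition_averages U T F"
  interpret prob_space P by (rule borel_probsD[OF P])
  \<comment> \<open>A placeholder state exists because \<open>P\<close> has mass 1. The same one
    serves all priors, policies and test functions.\<close>
  obtain x0 where x0: "x0 \<in> X" using not_empty borel_probsD(3)[OF P] by auto
  have G: "equicont_on X ?G"
    by (rule equicont_on_transition_averages[OF T weak compact Suc.prems(1,2)]) (rule Suc.prems(3))
  have GM: "\<bar>g x\<bar> \<le> M" if "g \<in> ?G" "x \<in> X" for g x
    by (rule transition_averages_bound[OF T Suc.prems(1) _ that]) (rule Suc.prems(3))
  have step: "expect R \<gamma> (Suc t) \<phi> = expect R \<gamma> t (\<lambda>\<omega> x. \<integral>y. (\<integral>z.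
      \<phi> (fun_upd \<omega> t (x0, y, control \<gamma> t \<omega> y)) z \<partial>T (x, control \<gamma> t \<omega> y)) \<partial>Q x)"
    if "R \<in> borel_probs X" "\<gamma> \<in> admissible_policies Y U" "\<phi> \<in> test_functions (Suc t) F" for R \<gamma> \<phi>
    by (rule expect_Suc[OF that x0]) (rule Suc.prems(3))
  have "\<forall>\<^sub>F n in sequentially. \<forall>\<gamma>\<in>admissible_policies Y U. \<forall>\<phi>\<in>test_functions t (mixtures X Y Q ?G).
    \<bar>expect (Ps n) \<gamma> t \<phi> - expect P \<gamma> t \<phi>\<bar> < e"
  proof (rule Suc.IH)
    show "equicont_on X (mixtures X Y Q ?G)"
      by (rule equicont_on_mixtures[OF Q tv G]) (rule GM)
    show "\<bar>f x\<bar> \<le> M" if "f \<in> mixtures X Y Q ?G" "x \<in> X" for f x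
      by (rule mixtures_bound[OF Q _ that]) (rule GM)
  qed (rule Suc.prems(2))
  then show ?case
    by eventually_elim (simp add: step P Ps test_functions_step[OF _ _ x0])
qed

end

section \<open>Expected stage costs and their discounted sum\<close>

definition stage_cost :: "('x \<times> 'u \<Rightarrow> real) \<Rightarrow> 'x measure \<Rightarrow> ('y, 'u) policy \<Rightarrow> nat \<Rightarrow> real" where
  "stage_cost c P \<gamma> t = (\<integral>\<omega>. c (state_at \<omega> t, control_at \<omega> t) \<partial>path_measure X Y U Q P T \<gamma>)"

context
  fixes c :: "'x \<times> 'u \<Rightarrow> real" and B :: real
  assumes c[measurable]: "c \<in> borel_measurable (borel_of X \<Otimes>\<^sub>M borel_of U)"
    and cB: "\<And>x u. x \<in> X \<Longrightarrow> u \<in> U \<Longrightarrow> \<bar>c (x, u)\<bar> \<le> B"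
begin

lemma measurable_path_cost:
  "(\<lambda>\<omega>. c (state_at \<omega> t, control_at \<omega> t)) \<in> borel_measurable (PiM UNIV (\<lambda>_. stage))"
proof -
  have xu: "(\<lambda>s. (fst s, snd (snd s))) \<in> stage \<rightarrow>\<^sub>M (borel_of X \<Otimes>\<^sub>M borel_of U)"
    unfolding stage_space_def by measurable
  have "(\<lambda>\<omega>. \<omega> t) \<in> PiM UNIV (\<lambda>_. stage) \<rightarrow>\<^sub>M stage" by simp
  from measurable_compose[OF measurable_compose[OF this xu] c] show ?thesis
    by (simp add: state_at_def control_at_def)
qed

lemma path_cost_bound:
  assumes "\<omega> \<in> space (PiM UNIV (\<lambda>_. stage))"
  shows "\<bar>c (state_at \<omega> t, control_at \<omega> t)\<bar> \<le> B"
proof -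
  have "\<omega> t \<in> X \<times> Y \<times> U" using assms by (auto simp: space_PiM space_stage)
  then show ?thesis by (intro cB) (auto simp: state_at_def control_at_def)
qed

lemma stage_cost_bound:
  assumes "P \<in> borel_probs X" "\<gamma> \<in> admissible_policies Y U"
  shows "\<bar>stage_cost c P \<gamma> t\<bar> \<le> B"
proof -
  note pm = path_measure_prob[OF assms]
  interpret prob_space "path_measure X Y U Q P T \<gamma>" by (rule pm)
  show ?thesis
    unfolding stage_cost_def using measurable_path_cost path_cost_bound pm(2) sets_eq_imp_space_eq[OF pm(2)]
    by (intro abs_integral_le) (simp_all cong: measurable_cong_sets)
qed

text \<open>The cost at \<open>t\<close> sees only stages up to \<open>t\<close>, so the path
  integral reduces to \<open>past_law\<close> at \<open>Suc t\<close>. Unfolding its last stage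
  leaves a function of the past and of the state at \<open>t\<close>, the form the uniform
  convergence result accepts.\<close>

lemma stage_cost_eq_expect:
  assumes "P \<in> borel_probs X" "\<gamma> \<in> admissible_policies Y U"
  shows "stage_cost c P \<gamma> t = expect P \<gamma> t (\<lambda>\<omega> x. \<integral>y. c (x, control \<gamma> t \<omega> y) \<partial>Q x)"
proof -
  let ?g = "\<lambda>\<omega>. c (state_at \<omega> t, control_at \<omega> t)"
  have g: "?g \<in> borel_measurable (past (Suc t))"
    by (rule measurable_compose[OF measurable_coordinate c]) simp
  have gB: "\<bar>?g \<omega>\<bar> \<le> B" if "\<omega> \<in> space (past (Suc t))" for \<omega>
  proof -
    have "\<omega> t \<in> X \<times> Y \<times> U" using that by (auto simp: space_PiM space_stage PiE_iff)
    then show ?thesis by (intro cB) (auto simp: state_at_def control_at_def)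
  qed
  have "stage_cost c P \<gamma> t = (\<integral>\<omega>. ?g \<omega> \<partial>past_law P \<gamma> (Suc t))"
    using integral_path_measure[OF assms g] by (simp add: stage_cost_def state_at_def control_at_def)
  also have "\<dots> = expect P \<gamma> t (\<lambda>\<omega> x. \<integral>y. ?g (fun_upd \<omega> t (x, y, control \<gamma> t \<omega> y)) \<partial>Q x)"
    by (rule integral_past_law_Suc[OF assms g gB])
  finally show ?thesis by (simp add: state_at_def control_at_def)
qed

lemma stage_cost_test_function:
  assumes \<gamma>: "\<gamma> \<in> admissible_policies Y U"
  shows "(\<lambda>\<omega> x. \<integral>y. c (x, control \<gamma> t \<omega> y) \<partial>Q x)
    \<in> test_functions t (mixtures X Y Q ((\<lambda>u x. c (x, u)) ` U))"
proof (rule test_functions_mixtures)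
  let ?M = "(past t \<Otimes>\<^sub>M borel_of X) \<Otimes>\<^sub>M borel_of Y"
  have cu: "(\<lambda>p. control \<gamma> t (fst (fst p)) (snd p)) \<in> ?M \<rightarrow>\<^sub>M borel_of U"
    using measurable_compose[OF _ measurable_control[OF \<gamma>], of "\<lambda>p. (fst (fst p), snd p)" ?M t]
    by simp
  have "(\<lambda>p. (snd (fst p), control \<gamma> t (fst (fst p)) (snd p))) \<in> ?M \<rightarrow>\<^sub>M borel_of X \<Otimes>\<^sub>M borel_of U"
    using cu by (intro measurable_Pair) measurable
  from measurable_compose[OF this c]
  show "(\<lambda>((\<omega>, x), y). c (x, control \<gamma> t \<omega> y)) \<in> borel_measurable ?M"
    by (simp add: split_beta')
next
  fix \<omega> \<omega>' :: "nat \<Rightarrow> 'x \<times> 'y \<times> 'u" and x y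
  assume "\<And>i. i < t \<Longrightarrow> snd (\<omega> i) = snd (\<omega>' i)"
  then show "c (x, control \<gamma> t \<omega> y) = c (x, control \<gamma> t \<omega>' y)"
    using control_cong[of t \<omega> \<omega>'] by simp
qed (use control_in[OF \<gamma>] in auto)

lemma discounted_cost_eq_suminf:
  assumes "P \<in> borel_probs X" "\<gamma> \<in> admissible_policies Y U" and \<beta>: "0 < \<beta>" "\<beta> < 1"
  shows "discounted_cost X Y U Q c \<beta> P T \<gamma> = (\<Sum>t. \<beta> ^ t * stage_cost c P \<gamma> t)"
proof -
  note pm = path_measure_prob[OF assms(1,2)]
  interpret prob_space "path_measure X Y U Q P T \<gamma>" by (rule pm)
  let ?f = "\<lambda>t \<omega>. \<beta> ^ t * c (state_at \<omega> t, control_at \<omega> t)"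
  note sp = sets_eq_imp_space_eq[OF pm(2)]
  have fm[measurable]: "?f t \<in> borel_measurable (path_measure X Y U Q P T \<gamma>)" for t
    using measurable_path_cost pm(2) by (simp cong: measurable_cong_sets)
  have fB: "\<bar>?f t \<omega>\<bar> \<le> \<beta> ^ t * B" if "\<omega> \<in> space (path_measure X Y U Q P T \<gamma>)" for t \<omega>
    using path_cost_bound[of \<omega> t] that sp \<beta> by (simp add: abs_mult)
  have s: "summable (\<lambda>t. \<beta> ^ t * B)" using \<beta> by (intro summable_mult2 summable_geometric) auto
  have "(\<integral>\<omega>. (\<Sum>t. ?f t \<omega>) \<partial>path_measure X Y U Q P T \<gamma>) =
      (\<Sum>t. \<integral>\<omega>. ?f t \<omega> \<partial>path_measure X Y U Q P T \<gamma>)"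
  proof (rule integral_suminf)
    show "integrable (path_measure X Y U Q P T \<gamma>) (?f t)" for t
      by (rule integrable_of_abs_le[OF fm fB])
    show "AE \<omega> in path_measure X Y U Q P T \<gamma>. summable (\<lambda>t. norm (?f t \<omega>))"
      using fB by (intro AE_I2 summable_comparison_test[OF _ s]) auto
    have "\<bar>\<integral>\<omega>. norm (?f t \<omega>) \<partial>path_measure X Y U Q P T \<gamma>\<bar> \<le> \<beta> ^ t * B" for t
      using fB by (intro abs_integral_le) auto
    then show "summable (\<lambda>t. \<integral>\<omega>. norm (?f t \<omega>) \<partial>path_measure X Y U Q P T \<gamma>)"
      by (intro summable_comparison_test[OF _ s]) auto
  qed
  then show ?thesis
    by (simp add: discounted_cost_def stage_cost_def)
qed

end

end

section \<open>Perturbation of infima and of discounted series\<close>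

lemma abs_INF_diff_le:
  fixes f g :: "'a \<Rightarrow> real"
  assumes "A \<noteq> {}" "bdd_below (f ` A)" "bdd_below (g ` A)" "\<And>x. x \<in> A \<Longrightarrow> \<bar>f x - g x\<bar> \<le> e"
  shows "\<bar>(INF x\<in>A. f x) - (INF x\<in>A. g x)\<bar> \<le> e"
proof -
  have le: "(INF x\<in>A. f x) - e \<le> (INF x\<in>A. g x)"
    if "bdd_below (f ` A)" "\<And>x. x \<in> A \<Longrightarrow> \<bar>f x - g x\<bar> \<le> e" for f g :: "'a \<Rightarrow> real"
  proof (rule cINF_greatest[OF assms(1)])
    fix x assume x: "x \<in> A"
    show "(INF x\<in>A. f x) - e \<le> g x"
      using cINF_lower[OF that(1) x] that(2)[OF x] by linarith
  qed
  show ?thesis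
    using le[of f g] le[of g f] assms(2-4) by (simp add: abs_le_iff abs_minus_commute)
qed

lemma abs_discounted_sum_le:
  fixes a :: "nat \<Rightarrow> real"
  assumes \<beta>: "0 < \<beta>" "\<beta> < 1" and "0 \<le> d" and a: "\<And>t. t < N \<Longrightarrow> \<bar>a t\<bar> \<le> d" "\<And>t. \<bar>a t\<bar> \<le> B"
  shows "\<bar>\<Sum>t. \<beta> ^ t * a t\<bar> \<le> (d + \<beta> ^ N * B) / (1 - \<beta>)"
proof -
  have B: "0 \<le> B" using a(2)[of 0] by linarith
  \<comment> \<open>The bound \<open>d\<close> is charged to every index and \<open>B\<close> to the
    tail in addition, so that the first part is a full geometric series and the second a shifted
    one.\<close>
  define b where "b t = \<beta> ^ t * d + (if t < N then 0 else \<beta> ^ t * B)" for t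
  have g: "(\<lambda>t. \<beta> ^ t) sums (1 / (1 - \<beta>))" using \<beta> by (intro geometric_sums) auto
  have "(\<lambda>t. \<beta> ^ N * (\<beta> ^ t * B)) sums (\<beta> ^ N * (1 / (1 - \<beta>) * B))"
    by (intro sums_mult sums_mult2 g)
  then have "(\<lambda>t. if t + N < N then 0 else \<beta> ^ (t + N) * B) sums (\<beta> ^ N * (1 / (1 - \<beta>) * B))"
    by (simp add: power_add mult_ac)
  then have "(\<lambda>t. if t < N then 0 else \<beta> ^ t * B) sums (\<beta> ^ N * (1 / (1 - \<beta>) * B))"
    by (subst (asm) sums_iff_shift) simp
  from sums_add[OF sums_mult2[OF g, of d] this]
  have b: "b sums ((d + \<beta> ^ N * B) / (1 - \<beta>))"
    by (simp add: b_def[abs_def] add_divide_distrib)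
  have le: "\<bar>\<beta> ^ t * a t\<bar> \<le> b t" for t
    using a(1)[of t] a(2)[of t] \<beta> \<open>0 \<le> d\<close> by (auto simp: b_def abs_mult intro: add_increasing)
  have s: "summable (\<lambda>t. \<bar>\<beta> ^ t * a t\<bar>)"
    by (rule summable_comparison_test[OF _ sums_summable[OF b]]) (use le in auto)
  have "\<bar>\<Sum>t. \<beta> ^ t * a t\<bar> \<le> (\<Sum>t. \<bar>\<beta> ^ t * a t\<bar>)" by (rule summable_rabs[OF s])
  also have "\<dots> \<le> suminf b" by (intro suminf_le le s sums_summable[OF b])
  finally show ?thesis using sums_unique[OF b] by simp
qed

theorem theorem2p12:
  fixes X :: "'x::euclidean_space set"
    and Y :: "'y::euclidean_space set"
    and U :: "'u::euclidean_space set"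
    and Q :: "'x \<Rightarrow> 'y measure"
    and T :: "'x \<times> 'u \<Rightarrow> 'x measure"
    and c :: "'x \<times> 'u \<Rightarrow> real"
    and \<beta> :: real
    and P :: "'x measure"
    and Ps :: "nat \<Rightarrow> 'x measure"
  assumes "X \<in> sets borel" and "Y \<in> sets borel" and "U \<in> sets borel"
    and "stochastic_kernel (borel_of X) (borel_of Y) Q"
    and "stochastic_kernel (borel_of X \<Otimes>\<^sub>M borel_of U) (borel_of X) T"
    and "0 < \<beta>" and "\<beta> < 1"
    and "weakly_continuous_kernel (X \<times> U) X T"
    and "tv_continuous_kernel X Q"
    and "\<And>x u. x \<in> X \<Longrightarrow> u \<in> U \<Longrightarrow> 0 \<le> c (x, u)"
    and "bounded (c ` (X \<times> U))"
    and "continuous_on (X \<times> U) c"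
    and "compact U"
    and "\<And>n. Ps n \<in> borel_probs X" and "P \<in> borel_probs X"
    and "converges_weakly X Ps P"
  shows "(\<lambda>n. \<bar>optimal_discounted_cost X Y U Q c \<beta> (Ps n) T
              - optimal_discounted_cost X Y U Q c \<beta> P T\<bar>) \<longlonglongrightarrow> 0"
proof (cases "admissible_policies Y U = {}")
  \<comment> \<open>Without policies both optimal costs are the infimum of the same empty set, so
    their difference is 0 whatever that value is.\<close>
  case True
  then show ?thesis by (simp add: optimal_discounted_cost_def)
next
  case nonempty: False
  interpret controlled_process X Y U Q T
    by unfold_locales (fact assms)+
  note \<beta> = \<open>0 < \<beta>\<close> \<open>\<beta> < 1\<close> and P = \<open>P \<in> borel_probs X\<close> and Ps = \<open>\<And>n. Ps n \<in> borel_probs X\<close>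
  obtain B where B: "0 < B" "\<And>p. p \<in> X \<times> U \<Longrightarrow> \<bar>c p\<bar> \<le> B"
    using \<open>bounded (c ` (X \<times> U))\<close> unfolding bounded_pos by auto
  then have cB: "\<bar>c (x, u)\<bar> \<le> B" if "x \<in> X" "u \<in> U" for x u using that by simp
  have c: "c \<in> borel_measurable (borel_of X \<Otimes>\<^sub>M borel_of U)"
    by (rule measurable_borel_of_Times_continuous) fact+
  let ?F = "mixtures X Y Q ((\<lambda>u x. c (x, u)) ` U)"
  \<comment> \<open>One family serves every stage: whatever the history, the expected cost of a
    stage, given its state, is a mixture of the functions \<open>c (\<cdot>, u)\<close> with
    \<open>u\<close> in \<open>U\<close>.\<close>
  have F: "equicont_on X ?F" "\<And>f x. f \<in> ?F \<Longrightarrow> x \<in> X \<Longrightarrow> \<bar>f x\<bar> \<le> B"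
    using equicont_on_mixtures[OF Q \<open>tv_continuous_kernel X Q\<close>
        equicont_on_compact_parameter[OF \<open>compact U\<close> \<open>continuous_on (X \<times> U) c\<close>], of B]
      mixtures_bound[OF Q, of "(\<lambda>u x. c (x, u)) ` U" B] cB by (fastforce simp: image_iff)+
  let ?J = "discounted_cost X Y U Q c \<beta>"
  have J: "?J R T \<gamma> = (\<Sum>t. \<beta> ^ t * stage_cost c R \<gamma> t)" "\<And>t. \<bar>stage_cost c R \<gamma> t\<bar> \<le> B"
    if "R \<in> borel_probs X" "\<gamma> \<in> admissible_policies Y U" for R \<gamma>
    using discounted_cost_eq_suminf[OF c cB that \<beta>] stage_cost_bound[OF c cB that] by auto
  have sm: "summable (\<lambda>t. \<beta> ^ t * a t)" if "\<And>t. \<bar>a t\<bar> \<le> B" for a :: "nat \<Rightarrow> real"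
  proof (rule summable_comparison_test)
    show "summable (\<lambda>t. \<beta> ^ t * B)" using \<beta> by (intro summable_mult2 summable_geometric) auto
    show "\<exists>N. \<forall>t\<ge>N. norm (\<beta> ^ t * a t) \<le> \<beta> ^ t * B"
      using that \<beta> by (auto simp: abs_mult intro!: mult_left_mono)
  qed
  have bdd: "bdd_below ((\<lambda>\<gamma>. ?J R T \<gamma>) ` admissible_policies Y U)" if R: "R \<in> borel_probs X" for R
  proof (rule bdd_belowI2)
    fix \<gamma> assume \<gamma>: "\<gamma> \<in> admissible_policies Y U"
    \<comment> \<open>Only some lower bound is required; cutoff 0 and \<open>d = B\<close> give a
      crude one.\<close>
    show "- ((B + \<beta> ^ 0 * B) / (1 - \<beta>)) \<le> ?J R T \<gamma>"
      using abs_discounted_sum_le[OF \<beta>, of B 0 "stage_cost c R \<gamma>" B] B(1) J[OF R \<gamma>]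
      by (simp add: abs_le_iff)
  qed
  have "\<forall>\<^sub>F n in sequentially. \<bar>optimal_discounted_cost X Y U Q c \<beta> (Ps n) T
              - optimal_discounted_cost X Y U Q c \<beta> P T\<bar> < e" if e: "e > 0" for e
  proof -
    \<comment> \<open>Chosen so that head and tail together give
      \<open>(d + d) / (1 - \<beta>) = e / 2\<close>. Infima preserve only non-strict bounds, and
      the other half of \<open>e\<close> restores strictness.\<close>
    define d where "d = e * (1 - \<beta>) / 4"
    have d: "d > 0" using e \<beta> by (simp add: d_def)
    have "(\<lambda>N. \<beta> ^ N * (2 * B)) \<longlonglongrightarrow> 0"
      using \<beta> by (intro tendsto_mult_left_zero LIMSEQ_power_zero) auto
    then have "\<forall>\<^sub>F N in sequentially. \<beta> ^ N * (2 * B) < d"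
      using d order_tendstoD(2) by blast
    then obtain N where N: "\<beta> ^ N * (2 * B) < d" by (auto simp: eventually_sequentially)
    have "\<forall>\<^sub>F n in sequentially. \<forall>\<gamma>\<in>admissible_policies Y U. \<forall>\<phi>\<in>test_functions t ?F.
        \<bar>expect (Ps n) \<gamma> t \<phi> - expect P \<gamma> t \<phi>\<bar> < d" for t
      by (rule expect_uniform_convergence[OF assms(8,9,13) P Ps assms(16) F(1), where M=B])
         (use B(1) F(2) d in auto)
    \<comment> \<open>The index from which the estimate holds may depend on the stage; only the
      finitely many stages below the cutoff \<open>N\<close> have to be combined.\<close>
    then have "\<forall>\<^sub>F n in sequentially. \<forall>t\<in>{..<N}. \<forall>\<gamma>\<in>admissible_policies Y U. \<forall>\<phi>\<in>test_functions t ?F.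
        \<bar>expect (Ps n) \<gamma> t \<phi> - expect P \<gamma> t \<phi>\<bar> < d"
      by (simp add: eventually_ball_finite_distrib)
    then show ?thesis
    proof eventually_elim
      case (elim n)
      have "\<bar>?J (Ps n) T \<gamma> - ?J P T \<gamma>\<bar> \<le> e / 2" if \<gamma>: "\<gamma> \<in> admissible_policies Y U" for \<gamma>
      proof -
        let ?a = "\<lambda>t. stage_cost c (Ps n) \<gamma> t - stage_cost c P \<gamma> t"
        have "?J (Ps n) T \<gamma> - ?J P T \<gamma> = (\<Sum>t. \<beta> ^ t * ?a t)"
          unfolding J(1)[OF P \<gamma>] J(1)[OF Ps \<gamma>] right_diff_distrib
          by (intro suminf_diff sm J(2) P Ps \<gamma>)
        also have "\<bar>\<dots>\<bar> \<le> (d + \<beta> ^ N * (2 * B)) / (1 - \<beta>)"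
        proof (rule abs_discounted_sum_le[OF \<beta>])
          fix t show "\<bar>?a t\<bar> \<le> 2 * B" using J(2)[OF P \<gamma>, of t] J(2)[OF Ps \<gamma>, of n t] by linarith
          assume "t < N"
          then show "\<bar>?a t\<bar> \<le> d"
            using elim \<gamma> stage_cost_test_function[OF c cB \<gamma>, of t]
            by (auto simp: stage_cost_eq_expect[OF c cB P \<gamma>] stage_cost_eq_expect[OF c cB Ps \<gamma>]
                intro: less_imp_le)
        qed (use d in simp)
        also have "\<dots> \<le> (d + d) / (1 - \<beta>)"
          using N \<beta> by (intro divide_right_mono) auto
        also have "\<dots> = e / 2" using \<beta> by (simp add: d_def field_simps)
        finally show ?thesis .
      qed
      then have "\<bar>optimal_discounted_cost X Y U Q c \<beta> (Ps n) T
          - optimal_discounted_cost X Y U Q c \<beta> P T\<bar> \<le> e / 2"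
        unfolding optimal_discounted_cost_def
        by (intro abs_INF_diff_le nonempty bdd P Ps)
      then show ?case using e by linarith
    qed
  qed
  then show ?thesis by (simp add: tendsto_iff)
qed

end
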